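(* Let $(\mathbf{C},\mathcal{M})$ satisfy the standing SqPO assumptions of the context, let $R_j=(r_j,\mathsf{c}_{I_j})$, $j=1,2$, be linear rules with application conditions, and let $X_0$ be an object. (Synthesis) Given a two-step sequence of SqPO derivations $X_1=r_{1,m_1}(X_0)$, $X_2=r_{2,m_2}(X_1)$ with $m_1\in M^{sq}_{R_1}(X_0)$, $m_2\in M^{sq}_{R_2}(X_1)$, there exist a unique $\mu_{21}\in M^{sq}_{R_2}(R_1)$ and a unique SqPO-admissible match $n\in M^{sq}_{R_{21}}(X_0)$ of $R_{21}=R_2\,{}^{\mu_{21}}\!\!\circ_{sq}R_1$ such that $r_{21,n}(X_0)\cong X_2$. (Analysis) Given $\mu_{21}\in M^{sq}_{R_2}(R_1)$ and $n\in M^{sq}_{R_{21}}(X_0)$ for $R_{21}=R_2\,{}^{\mu_{21}}\!\!\circ_{sq}R_1$, there exists a unique pair of SqPO-admissible matches $m_1\in M^{sq}_{R_1}(X_0)$, $m_2\in M^{sq}_{R_2}(X_1)$ with $X_1=r_{1,m_1}(X_0)$ such that $r_{2,m_2}(X_1)\cong r_{21,n}(X_0)$.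
   Context: Standing SqPO assumptions: $(\mathbf{C},\mathcal{M})$ is $\mathcal{M}$-adhesive with $\mathcal{M}$ a class of monomorphisms (contains isos; closed under composition and decomposition; pushouts/pullbacks along $\mathcal{M}$-morphisms exist and preserve $\mathcal{M}$; pushouts along $\mathcal{M}$-morphisms are $\mathcal{M}$-van Kampen), with epi-$\mathcal{M}$-factorizations, balanced, with a strict $\mathcal{M}$-initial object, with $\mathcal{M}$-effective unions (if $\mathcal{M}$-morphisms $B\leftarrow A\to C$ have pushout $D$ and $\mathcal{M}$-morphisms $B\to E\leftarrow C$ form with them a pullback square, the induced $D\to E$ is in $\mathcal{M}$). A pair $(b:A\to D,d:D\to C)$ is a final pullback complement (FPC) of composable $A\xrightarrow{a}B\xrightarrow{c}C$ if $ca=db$ is a pullback and for every pullback square $c\circ x=z\circ y$ ($x:P\to B$, $y:P\to Q$, $z:Q\to C$) and $w:P\to A$ with $aw=x$ there is a unique $w^*:Q\to D$ with $dw^*=z$, $w^*y=w$. FPCs of all composable pairs of $\mathcal{M}$-morphisms exist and consist of $\mathcal{M}$-morphisms. Conditions over $P$: $\mathsf{true}$, $\exists(a,\mathsf{c}_Q)$ ($a:P\to Q$ in $\mathcal{M}$), $\neg$, $\bigwedge$; $\mathsf{false}=\neg\mathsf{true}$; an $\mathcal{M}$-morphism $p$ satisfies $\exists(a,\mathsf{c}_Q)$ iff $p=q a$ for an $\mathcal{M}$-morphism $q\models\mathsf{c}_Q$; $\equiv$ means satisfied by the same $\mathcal{M}$-morphisms. $\mathsf{Shift}(p,\cdot)$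 along an $\mathcal{M}$-morphism $p:P\to Q$ commutes with $\mathsf{true},\neg,\bigwedge$, and $\mathsf{Shift}(p,\exists(a:P\to A,\mathsf{c}_A))=\bigvee_{(r,s)}\exists(r,\mathsf{Shift}(s,\mathsf{c}_A))$ over iso classes of pushouts $(r:Q\to E,s:A\to E)$ of spans $Q\xleftarrow{p''}X\xrightarrow{a''}A$ of $\mathcal{M}$-morphisms with some $\mathcal{M}$-morphism $x:P\to X$, $p''x=p$, $a''x=a$. A linear rule is a span $r=(O\xleftarrow{o}K\xrightarrow{i}I)$ of $\mathcal{M}$-morphisms; $R=(r,\mathsf{c}_I)$. $\mathsf{Trans}(r,\mathsf{c}_O)$ commutes with $\mathsf{true},\neg,\bigwedge$ and sends $\exists(a:O\to O',\mathsf{c}')$ to $\exists(a^*,\mathsf{Trans}(r',\mathsf{c}'))$ if the pushout complement $K\to K'\xrightarrow{o'}O'$ of $K\xrightarrow{o}O\xrightarrow{a}O'$ exists ($I\xrightarrow{a^*}I'\xleftarrow{i'}K'$ the pushout of $I\leftarrow K\to K'$, $r'=(O'\xleftarrow{o'}K'\xrightarrow{i'}I')$), else to $\mathsf{false}$. SqPO rewriting: for any $\mathcal{M}$-morphism $m:I\to X$, let $K\to\bar K\to X$ be the FPC of $K\xrightarrow{i}I\xrightarrow{m}X$ and $r_m(X)$ the pushout of $O\xleftarrow{o}K\to\bar K$; $M^{sq}_R(X)=\{m:I\to X\text{ in }\mathcal{M}\mid m\models\mathsf{c}_I\}$. SqPO composition: for $R_j=(r_j,\mathsf{c}_{I_j})$,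 $r_j=(O_j\xleftarrow{o_j}K_j\xrightarrow{i_j}I_j)$, and a span of $\mathcal{M}$-morphisms $\mu_{21}=(I_2\leftarrow M_{21}\to O_1)$, let $I_2\xrightarrow{m_2'}N_{21}\xleftarrow{m_1'}O_1$ be its pushout; $K_2\to K_2'\to N_{21}$ the FPC of $K_2\xrightarrow{i_2}I_2\to N_{21}$; require a pushout complement $K_1\to K_1'\to N_{21}$ of $K_1\xrightarrow{o_1}O_1\to N_{21}$; $O_{21}$ = pushout of $O_2\leftarrow K_2\to K_2'$; $I_{21}$ = pushout of $K_1'\leftarrow K_1\to I_1$ (with $p_1:I_1\to I_{21}$); $K_{21}$ = pullback of $K_2'\to N_{21}\leftarrow K_1'$; $r_{21}=(O_{21}\leftarrow K_{21}\to I_{21})$; $\mathsf{c}_{I_{21}}=\mathsf{Shift}(p_1,\mathsf{c}_{I_1})\wedge\mathsf{Trans}((N_{21}\leftarrow K_1'\to I_{21}),\mathsf{Shift}(m_2',\mathsf{c}_{I_2}))$. If constructible and $\mathsf{c}_{I_{21}}\not\equiv\mathsf{false}$, $\mu_{21}\in M^{sq}_{R_2}(R_1)$ and $R_2\,{}^{\mu_{21}}\!\!\circ_{sq}R_1=(r_{21},\mathsf{c}_{I_{21}})$.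
   Formalization: Uniqueness of μ21 (up to span isomorphism), n and (m1,m2) is among those fitting one commuting diagram (N21→X1, K1'→K̄1, n:I21→X0, restricting to m1, m2 and the comatch of m1); with only r21,n(X0)≅X2 required, uniqueness is false. The FPC axiom is read as w*y=bw. *)

theory Defs
  imports Main
begin

section \<open>Categories\<close>

record ('o, 'm) category_data =
  Obj :: "'o set"
  Arr :: "'m set"
  Dom :: "'m \<Rightarrow> 'o"
  Cod :: "'m \<Rightarrow> 'o"
  Ident :: "'o \<Rightarrow> 'm"
  Comp :: "'m \<Rightarrow> 'm \<Rightarrow> 'm" (infixl "\<cdot>\<index>" 70)

definition hom :: "('o, 'm) category_data \<Rightarrow> 'o \<Rightarrow> 'o \<Rightarrow> 'm set" where
  "hom C X Y = {f \<in> Arr C. Dom C f = X \<and> Cod C f = Y}"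

locale category =
  fixes C :: "('o, 'm) category_data" (structure)
  assumes Dom_in_Obj: "f \<in> Arr C \<Longrightarrow> Dom C f \<in> Obj C"
    and Cod_in_Obj: "f \<in> Arr C \<Longrightarrow> Cod C f \<in> Obj C"
    and Ident_in_hom: "X \<in> Obj C \<Longrightarrow> Ident C X \<in> hom C X X"
    and Comp_in_hom: "f \<in> hom C X Y \<Longrightarrow> g \<in> hom C Y Z \<Longrightarrow> g \<cdot> f \<in> hom C X Z"
    and Ident_right: "f \<in> hom C X Y \<Longrightarrow> f \<cdot> Ident C X = f"
    and Ident_left: "f \<in> hom C X Y \<Longrightarrow> Ident C Y \<cdot> f = f"
    and Comp_assoc: "f \<in> hom C W X \<Longrightarrow> g \<in> hom C X Y \<Longrightarrow> h \<in> hom C Y Z \<Longrightarrow>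
          (h \<cdot> g) \<cdot> f = h \<cdot> (g \<cdot> f)"

definition mono :: "('o, 'm) category_data \<Rightarrow> 'm \<Rightarrow> bool" where
  "mono C f \<longleftrightarrow> f \<in> Arr C \<and>
     (\<forall>X. \<forall>g \<in> hom C X (Dom C f). \<forall>h \<in> hom C X (Dom C f).
        f \<cdot>\<^bsub>C\<^esub> g = f \<cdot>\<^bsub>C\<^esub> h \<longrightarrow> g = h)"

definition epi :: "('o, 'm) category_data \<Rightarrow> 'm \<Rightarrow> bool" where
  "epi C f \<longleftrightarrow> f \<in> Arr C \<and>
     (\<forall>Y. \<forall>g \<in> hom C (Cod C f) Y. \<forall>h \<in> hom C (Cod C f) Y.
        g \<cdot>\<^bsub>C\<^esub> f = h \<cdot>\<^bsub>C\<^esub> f \<longrightarrow> g = h)"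

definition iso :: "('o, 'm) category_data \<Rightarrow> 'm \<Rightarrow> bool" where
  "iso C f \<longleftrightarrow> f \<in> Arr C \<and>
     (\<exists>g \<in> hom C (Cod C f) (Dom C f).
        g \<cdot>\<^bsub>C\<^esub> f = Ident C (Dom C f) \<and> f \<cdot>\<^bsub>C\<^esub> g = Ident C (Cod C f))"

definition isomorphic :: "('o, 'm) category_data \<Rightarrow> 'o \<Rightarrow> 'o \<Rightarrow> bool" where
  "isomorphic C X Y \<longleftrightarrow> (\<exists>\<phi> \<in> hom C X Y. iso C \<phi>)"

text \<open>All squares are written in the order \<open>f g h k\<close> with
  \<open>f : A \<rightarrow> B\<close>, \<open>g : A \<rightarrow> D\<close>, \<open>h : B \<rightarrow> E\<close>, \<open>k : D \<rightarrow> E\<close> and \<open>h f = k g\<close>;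
  thus \<open>k\<close> is opposite to \<open>f\<close>, and \<open>h\<close> is opposite to \<open>g\<close>.\<close>

definition comm_square :: "('o, 'm) category_data \<Rightarrow> 'm \<Rightarrow> 'm \<Rightarrow> 'm \<Rightarrow> 'm \<Rightarrow> bool" where
  "comm_square C f g h k \<longleftrightarrow>
     {f, g, h, k} \<subseteq> Arr C \<and> Dom C f = Dom C g \<and> Cod C f = Dom C h \<and> Cod C g = Dom C k \<and>
     Cod C h = Cod C k \<and> h \<cdot>\<^bsub>C\<^esub> f = k \<cdot>\<^bsub>C\<^esub> g"

definition pushout :: "('o, 'm) category_data \<Rightarrow> 'm \<Rightarrow> 'm \<Rightarrow> 'm \<Rightarrow> 'm \<Rightarrow> bool" where
  "pushout C f g h k \<longleftrightarrow> comm_square C f g h k \<and>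
     (\<forall>h' k'. comm_square C f g h' k' \<longrightarrow>
        (\<exists>!u. u \<in> hom C (Cod C h) (Cod C h') \<and> u \<cdot>\<^bsub>C\<^esub> h = h' \<and> u \<cdot>\<^bsub>C\<^esub> k = k'))"

definition pullback :: "('o, 'm) category_data \<Rightarrow> 'm \<Rightarrow> 'm \<Rightarrow> 'm \<Rightarrow> 'm \<Rightarrow> bool" where
  "pullback C f g h k \<longleftrightarrow> comm_square C f g h k \<and>
     (\<forall>f' g'. comm_square C f' g' h k \<longrightarrow>
        (\<exists>!u. u \<in> hom C (Dom C f') (Dom C f) \<and> f \<cdot>\<^bsub>C\<^esub> u = f' \<and> g \<cdot>\<^bsub>C\<^esub> u = g'))"

text \<open>\<open>fpc C a c b d\<close>: the pair \<open>b : A \<rightarrow> D\<close>, \<open>d : D \<rightarrow> E\<close> is a final pullback complement of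
  \<open>a : A \<rightarrow> B\<close>, \<open>c : B \<rightarrow> E\<close>.\<close>

definition fpc :: "('o, 'm) category_data \<Rightarrow> 'm \<Rightarrow> 'm \<Rightarrow> 'm \<Rightarrow> 'm \<Rightarrow> bool" where
  "fpc C a c b d \<longleftrightarrow> pullback C a b c d \<and>
     (\<forall>x y z w. pullback C x y c z \<longrightarrow> w \<in> hom C (Dom C x) (Dom C a) \<longrightarrow> a \<cdot>\<^bsub>C\<^esub> w = x \<longrightarrow>
        (\<exists>!u. u \<in> hom C (Cod C y) (Cod C b) \<and>
              d \<cdot>\<^bsub>C\<^esub> u = z \<and> u \<cdot>\<^bsub>C\<^esub> y = b \<cdot>\<^bsub>C\<^esub> w))"

text \<open>The cube has the square \<open>f g h k\<close> as bottom face, \<open>f' g' h' k'\<close> as top face and the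
  vertical arrows \<open>a b c d\<close>, which are required to lie in \<open>M\<close>.\<close>

definition M_van_Kampen ::
  "('o, 'm) category_data \<Rightarrow> 'm set \<Rightarrow> 'm \<Rightarrow> 'm \<Rightarrow> 'm \<Rightarrow> 'm \<Rightarrow> bool" where
  "M_van_Kampen C M f g h k \<longleftrightarrow>
     (\<forall>f' g' h' k' a b c d.
        {a, b, c, d} \<subseteq> M \<longrightarrow>
        comm_square C f' g' h' k' \<longrightarrow>
        comm_square C h' b d h \<longrightarrow> comm_square C k' c d k \<longrightarrow>
        pullback C f' a b f \<longrightarrow> pullback C g' a c g \<longrightarrow>
        (pushout C f' g' h' k' \<longleftrightarrow> pullback C h' b d h \<and> pullback C k' c d k))"

locale M_adhesive = category C for C :: "('o, 'm) category_data" (structure) +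
  fixes M :: "'m set"
  assumes M_mono: "f \<in> M \<Longrightarrow> mono C f"
    and iso_in_M: "iso C f \<Longrightarrow> f \<in> M"
    and M_Comp: "f \<in> M \<Longrightarrow> g \<in> M \<Longrightarrow> Cod C f = Dom C g \<Longrightarrow> g \<cdot> f \<in> M"
    and M_decomp: "f \<in> Arr C \<Longrightarrow> g \<in> M \<Longrightarrow> Cod C f = Dom C g \<Longrightarrow> g \<cdot> f \<in> M \<Longrightarrow> f \<in> M"
    and pushout_along_M_ex:
      "f \<in> M \<Longrightarrow> g \<in> Arr C \<Longrightarrow> Dom C f = Dom C g \<Longrightarrow> \<exists>h k. pushout C f g h k"
    and pushout_M: "f \<in> M \<Longrightarrow> pushout C f g h k \<Longrightarrow> k \<in> M"
    and pullback_along_M_ex: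
      "h \<in> M \<Longrightarrow> k \<in> Arr C \<Longrightarrow> Cod C h = Cod C k \<Longrightarrow> \<exists>f g. pullback C f g h k"
    and pullback_M: "h \<in> M \<Longrightarrow> pullback C f g h k \<Longrightarrow> g \<in> M"
    and pushout_van_Kampen: "f \<in> M \<Longrightarrow> pushout C f g h k \<Longrightarrow> M_van_Kampen C M f g h k"

locale sqpo_category = M_adhesive C M
  for C :: "('o, 'm) category_data" (structure) and M :: "'m set" +
  assumes epi_M_factorization:
      "f \<in> Arr C \<Longrightarrow> \<exists>e m. epi C e \<and> m \<in> M \<and> Cod C e = Dom C m \<and> f = m \<cdot> e"
    and balanced: "mono C f \<Longrightarrow> epi C f \<Longrightarrow> iso C f"
    and strict_M_initial:
      "\<exists>Z \<in> Obj C. \<forall>X \<in> Obj C.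
         (\<exists>!f. f \<in> hom C Z X) \<and> hom C Z X \<subseteq> M \<and> (\<forall>f \<in> hom C X Z. iso C f)"
    and M_effective_unions:
      "f \<in> M \<Longrightarrow> g \<in> M \<Longrightarrow> pushout C f g h k \<Longrightarrow>
       p \<in> M \<Longrightarrow> q \<in> M \<Longrightarrow> pullback C f g p q \<Longrightarrow>
       u \<in> hom C (Cod C h) (Cod C p) \<Longrightarrow> u \<cdot> h = p \<Longrightarrow> u \<cdot> k = q \<Longrightarrow> u \<in> M"
    and fpc_ex: "a \<in> M \<Longrightarrow> c \<in> M \<Longrightarrow> Cod C a = Dom C c \<Longrightarrow> \<exists>b d. fpc C a c b d"
    and fpc_M: "a \<in> M \<Longrightarrow> c \<in> M \<Longrightarrow> fpc C a c b d \<Longrightarrow> b \<in> M \<and> d \<in> M"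

text \<open>Chosen universal constructions. They are arbitrary choices among the objects with the
  respective universal property and are meaningful only where such objects exist.\<close>

definition the_pushout :: "('o, 'm) category_data \<Rightarrow> 'm \<Rightarrow> 'm \<Rightarrow> 'm \<times> 'm" where
  "the_pushout C f g = (SOME (h, k). pushout C f g h k)"

definition the_pullback :: "('o, 'm) category_data \<Rightarrow> 'm \<Rightarrow> 'm \<Rightarrow> 'm \<times> 'm" where
  "the_pullback C h k = (SOME (f, g). pullback C f g h k)"

definition the_fpc :: "('o, 'm) category_data \<Rightarrow> 'm \<Rightarrow> 'm \<Rightarrow> 'm \<times> 'm" where
  "the_fpc C a c = (SOME (b, d). fpc C a c b d)"

text \<open>Pushout complements of \<open>f : K \<rightarrow> B\<close>, \<open>h : B \<rightarrow> E\<close>, given as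
  \<open>g : K \<rightarrow> K'\<close>, \<open>k : K' \<rightarrow> E\<close>.\<close>

definition has_poc :: "('o, 'm) category_data \<Rightarrow> 'm \<Rightarrow> 'm \<Rightarrow> bool" where
  "has_poc C f h \<longleftrightarrow> (\<exists>g k. pushout C f g h k)"

definition the_poc :: "('o, 'm) category_data \<Rightarrow> 'm \<Rightarrow> 'm \<Rightarrow> 'm \<times> 'm" where
  "the_poc C f h = (SOME (g, k). pushout C f g h k)"


section \<open>Conditions\<close>

text \<open>Conjunctions range over a set of indices of type \<open>'i + 'm \<times> 'm\<close>: the type \<open>'i\<close> is
  arbitrary, and the second summand provides the indices needed for the disjunctions (over pairs
  of morphisms) that are introduced by \<open>Shift\<close>. Only the members of the family with index in
  the given set matter.\<close>

datatype ('m, 'i) acond =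
    CTrue
  | CEx 'm "('m, 'i) acond"
  | CNot "('m, 'i) acond"
  | CConj "('i + 'm \<times> 'm) set" "('i + 'm \<times> 'm) \<Rightarrow> ('m, 'i) acond"

definition CFalse :: "('m, 'i) acond" where
  "CFalse = CNot CTrue"

definition CDisj ::
  "('i + 'm \<times> 'm) set \<Rightarrow> ('i + 'm \<times> 'm \<Rightarrow> ('m, 'i) acond) \<Rightarrow> ('m, 'i) acond" where
  "CDisj J F = CNot (CConj J (\<lambda>j. CNot (F j)))"

definition CAnd :: "('m, 'i) acond \<Rightarrow> ('m, 'i) acond \<Rightarrow> ('m, 'i) acond" where
  "CAnd c d = CConj {Inl undefined, Inr undefined} (case_sum (\<lambda>_. c) (\<lambda>_. d))"

primrec cond_over ::
  "('o, 'm) category_data \<Rightarrow> 'm set \<Rightarrow> ('m, 'i) acond \<Rightarrow> 'o \<Rightarrow> bool" where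
  "cond_over C M CTrue P \<longleftrightarrow> P \<in> Obj C"
| "cond_over C M (CEx a c) P \<longleftrightarrow> a \<in> M \<and> Dom C a = P \<and> cond_over C M c (Cod C a)"
| "cond_over C M (CNot c) P \<longleftrightarrow> cond_over C M c P"
| "cond_over C M (CConj J F) P \<longleftrightarrow> P \<in> Obj C \<and> (\<forall>j \<in> J. cond_over C M (F j) P)"

primrec sat :: "('o, 'm) category_data \<Rightarrow> 'm set \<Rightarrow> ('m, 'i) acond \<Rightarrow> 'm \<Rightarrow> bool" where
  "sat C M CTrue p \<longleftrightarrow> True"
| "sat C M (CEx a c) p \<longleftrightarrow>
     (\<exists>q \<in> M. q \<in> hom C (Cod C a) (Cod C p) \<and> p = q \<cdot>\<^bsub>C\<^esub> a \<and> sat C M c q)"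
| "sat C M (CNot c) p \<longleftrightarrow> \<not> sat C M c p"
| "sat C M (CConj J F) p \<longleftrightarrow> (\<forall>j \<in> J. sat C M (F j) p)"

definition cond_equiv ::
  "('o, 'm) category_data \<Rightarrow> 'm set \<Rightarrow> 'o \<Rightarrow> ('m, 'i) acond \<Rightarrow> ('m, 'i) acond \<Rightarrow> bool" where
  "cond_equiv C M P c d \<longleftrightarrow> (\<forall>p \<in> M. Dom C p = P \<longrightarrow> (sat C M c p \<longleftrightarrow> sat C M d p))"

definition shift_cospans ::
  "('o, 'm) category_data \<Rightarrow> 'm set \<Rightarrow> 'm \<Rightarrow> 'm \<Rightarrow> ('m \<times> 'm) set" where
  "shift_cospans C M p a =
     {(r, s). \<exists>X. \<exists>p'' \<in> M \<inter> hom C X (Cod C p). \<exists>a'' \<in> M \<inter> hom C X (Cod C a).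
        (\<exists>x \<in> M \<inter> hom C (Dom C p) X. p'' \<cdot>\<^bsub>C\<^esub> x = p \<and> a'' \<cdot>\<^bsub>C\<^esub> x = a) \<and>
        pushout C p'' a'' r s}"

definition cospan_iso :: "('o, 'm) category_data \<Rightarrow> 'm \<times> 'm \<Rightarrow> 'm \<times> 'm \<Rightarrow> bool" where
  "cospan_iso C rs rs' \<longleftrightarrow>
     (\<exists>\<phi> \<in> hom C (Cod C (fst rs)) (Cod C (fst rs')). iso C \<phi> \<and>
        \<phi> \<cdot>\<^bsub>C\<^esub> fst rs = fst rs' \<and> \<phi> \<cdot>\<^bsub>C\<^esub> snd rs = snd rs')"

text \<open>One representative for each isomorphism class.\<close>

definition shift_reps ::
  "('o, 'm) category_data \<Rightarrow> 'm set \<Rightarrow> 'm \<Rightarrow> 'm \<Rightarrow> ('m \<times> 'm) set" where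
  "shift_reps C M p a =
     (\<lambda>K. SOME rs. rs \<in> K) `
       (shift_cospans C M p a //
         {(rs, rs'). rs \<in> shift_cospans C M p a \<and> rs' \<in> shift_cospans C M p a \<and>
                     cospan_iso C rs rs'})"

primrec Shift ::
  "('o, 'm) category_data \<Rightarrow> 'm set \<Rightarrow> ('m, 'i) acond \<Rightarrow> 'm \<Rightarrow> ('m, 'i) acond" where
  "Shift C M CTrue p = CTrue"
| "Shift C M (CEx a c) p =
     CDisj (Inr ` shift_reps C M p a)
       (case_sum (\<lambda>_. CTrue) (\<lambda>(r, s). CEx r (Shift C M c s)))"
| "Shift C M (CNot c) p = CNot (Shift C M c p)"
| "Shift C M (CConj J F) p = CConj J (\<lambda>j. Shift C M (F j) p)"

text \<open>The last two arguments are the legs \<open>o : K \<rightarrow> O\<close> and \<open>i : K \<rightarrow> I\<close> of the rule.\<close>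

primrec Trans ::
  "('o, 'm) category_data \<Rightarrow> ('m, 'i) acond \<Rightarrow> 'm \<Rightarrow> 'm \<Rightarrow> ('m, 'i) acond" where
  "Trans C CTrue ko ki = CTrue"
| "Trans C (CEx a c) ko ki =
     (if has_poc C ko a
      then (case the_poc C ko a of (k', ko') \<Rightarrow>
            case the_pushout C ki k' of (a', ki') \<Rightarrow> CEx a' (Trans C c ko' ki'))
      else CFalse)"
| "Trans C (CNot c) ko ki = CNot (Trans C c ko ki)"
| "Trans C (CConj J F) ko ki = CConj J (\<lambda>j. Trans C (F j) ko ki)"


section \<open>Rules and SqPO rewriting\<close>

text \<open>A span \<open>O \<leftarrow> K \<rightarrow> I\<close> with a condition over \<open>I\<close>.\<close>

record ('m, 'i) rule =
  outm :: 'm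
  inm :: 'm
  acond :: "('m, 'i) acond"

definition linear_rule :: "('o, 'm) category_data \<Rightarrow> 'm set \<Rightarrow> ('m, 'i) rule \<Rightarrow> bool" where
  "linear_rule C M R \<longleftrightarrow> outm R \<in> M \<and> inm R \<in> M \<and> Dom C (outm R) = Dom C (inm R) \<and>
     cond_over C M (acond R) (Cod C (inm R))"

definition matches ::
  "('o, 'm) category_data \<Rightarrow> 'm set \<Rightarrow> ('m, 'i) rule \<Rightarrow> 'o \<Rightarrow> 'm set" where
  "matches C M R X = {m \<in> M. m \<in> hom C (Cod C (inm R)) X \<and> sat C M (acond R) m}"

text \<open>The diagram of a derivation at \<open>m : I \<rightarrow> X\<close>, where \<open>L\<close> is the context object:
  \<open>sqpo_fpc = (K \<rightarrow> L, L \<rightarrow> X)\<close> and \<open>sqpo_pushout = (O \<rightarrow> r\<^sub>m(X), L \<rightarrow> r\<^sub>m(X))\<close>.\<close>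

definition sqpo_fpc :: "('o, 'm) category_data \<Rightarrow> ('m, 'i) rule \<Rightarrow> 'm \<Rightarrow> 'm \<times> 'm" where
  "sqpo_fpc C R m = the_fpc C (inm R) m"

definition sqpo_pushout :: "('o, 'm) category_data \<Rightarrow> ('m, 'i) rule \<Rightarrow> 'm \<Rightarrow> 'm \<times> 'm" where
  "sqpo_pushout C R m = the_pushout C (outm R) (fst (sqpo_fpc C R m))"

definition rewrite :: "('o, 'm) category_data \<Rightarrow> ('m, 'i) rule \<Rightarrow> 'm \<Rightarrow> 'o" where
  "rewrite C R m = Cod C (fst (sqpo_pushout C R m))"


section \<open>SqPO composition\<close>

text \<open>An overlap is a span \<open>\<mu> = (M\<^sub>2\<^sub>1 \<rightarrow> I\<^sub>2, M\<^sub>2\<^sub>1 \<rightarrow> O\<^sub>1)\<close>. The constructions below yield, in this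
  order,
  \<open>comp_union = (I\<^sub>2 \<rightarrow> N\<^sub>2\<^sub>1, O\<^sub>1 \<rightarrow> N\<^sub>2\<^sub>1)\<close>,
  \<open>comp_fpc2 = (K\<^sub>2 \<rightarrow> K\<^sub>2', K\<^sub>2' \<rightarrow> N\<^sub>2\<^sub>1)\<close>,
  \<open>comp_poc1 = (K\<^sub>1 \<rightarrow> K\<^sub>1', K\<^sub>1' \<rightarrow> N\<^sub>2\<^sub>1)\<close>,
  \<open>comp_out = (O\<^sub>2 \<rightarrow> O\<^sub>2\<^sub>1, K\<^sub>2' \<rightarrow> O\<^sub>2\<^sub>1)\<close>,
  \<open>comp_in = (I\<^sub>1 \<rightarrow> I\<^sub>2\<^sub>1, K\<^sub>1' \<rightarrow> I\<^sub>2\<^sub>1)\<close> and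
  \<open>comp_ctx = (K\<^sub>2\<^sub>1 \<rightarrow> K\<^sub>2', K\<^sub>2\<^sub>1 \<rightarrow> K\<^sub>1')\<close>.\<close>

definition comp_union :: "('o, 'm) category_data \<Rightarrow> 'm \<times> 'm \<Rightarrow> 'm \<times> 'm" where
  "comp_union C \<mu> = the_pushout C (fst \<mu>) (snd \<mu>)"

definition comp_fpc2 ::
  "('o, 'm) category_data \<Rightarrow> ('m, 'i) rule \<Rightarrow> 'm \<times> 'm \<Rightarrow> 'm \<times> 'm" where
  "comp_fpc2 C R2 \<mu> = the_fpc C (inm R2) (fst (comp_union C \<mu>))"

definition comp_poc1 ::
  "('o, 'm) category_data \<Rightarrow> 'm \<times> 'm \<Rightarrow> ('m, 'i) rule \<Rightarrow> 'm \<times> 'm" where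
  "comp_poc1 C \<mu> R1 = the_poc C (outm R1) (snd (comp_union C \<mu>))"

definition comp_out ::
  "('o, 'm) category_data \<Rightarrow> ('m, 'i) rule \<Rightarrow> 'm \<times> 'm \<Rightarrow> 'm \<times> 'm" where
  "comp_out C R2 \<mu> = the_pushout C (outm R2) (fst (comp_fpc2 C R2 \<mu>))"

definition comp_in ::
  "('o, 'm) category_data \<Rightarrow> 'm \<times> 'm \<Rightarrow> ('m, 'i) rule \<Rightarrow> 'm \<times> 'm" where
  "comp_in C \<mu> R1 = the_pushout C (inm R1) (fst (comp_poc1 C \<mu> R1))"

definition comp_ctx ::
  "('o, 'm) category_data \<Rightarrow> ('m, 'i) rule \<Rightarrow> 'm \<times> 'm \<Rightarrow> ('m, 'i) rule \<Rightarrow> 'm \<times> 'm" where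
  "comp_ctx C R2 \<mu> R1 = the_pullback C (snd (comp_fpc2 C R2 \<mu>)) (snd (comp_poc1 C \<mu> R1))"

definition comp_cond ::
  "('o, 'm) category_data \<Rightarrow> 'm set \<Rightarrow> ('m, 'i) rule \<Rightarrow> 'm \<times> 'm \<Rightarrow> ('m, 'i) rule \<Rightarrow>
   ('m, 'i) acond" where
  "comp_cond C M R2 \<mu> R1 =
     CAnd (Shift C M (acond R1) (fst (comp_in C \<mu> R1)))
          (Trans C (Shift C M (acond R2) (fst (comp_union C \<mu>)))
             (snd (comp_poc1 C \<mu> R1)) (snd (comp_in C \<mu> R1)))"

definition comp_rule ::
  "('o, 'm) category_data \<Rightarrow> 'm set \<Rightarrow> ('m, 'i) rule \<Rightarrow> 'm \<times> 'm \<Rightarrow> ('m, 'i) rule \<Rightarrow>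
   ('m, 'i) rule" where
  "comp_rule C M R2 \<mu> R1 =
     \<lparr> outm = snd (comp_out C R2 \<mu>) \<cdot>\<^bsub>C\<^esub> fst (comp_ctx C R2 \<mu> R1),
       inm = snd (comp_in C \<mu> R1) \<cdot>\<^bsub>C\<^esub> snd (comp_ctx C R2 \<mu> R1),
       acond = comp_cond C M R2 \<mu> R1 \<rparr>"

text \<open>Of all the constructions entering the composite, only the pushout complement may fail to
  exist.\<close>

definition overlaps ::
  "('o, 'm) category_data \<Rightarrow> 'm set \<Rightarrow> ('m, 'i) rule \<Rightarrow> ('m, 'i) rule \<Rightarrow> ('m \<times> 'm) set" where
  "overlaps C M R2 R1 =
     {\<mu>. fst \<mu> \<in> M \<and> snd \<mu> \<in> M \<and> Dom C (fst \<mu>) = Dom C (snd \<mu>) \<and>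
         Cod C (fst \<mu>) = Cod C (inm R2) \<and> Cod C (snd \<mu>) = Cod C (outm R1) \<and>
         has_poc C (outm R1) (snd (comp_union C \<mu>)) \<and>
         \<not> cond_equiv C M (Cod C (fst (comp_in C \<mu> R1))) (comp_cond C M R2 \<mu> R1) CFalse}"

definition span_iso :: "('o, 'm) category_data \<Rightarrow> 'm \<times> 'm \<Rightarrow> 'm \<times> 'm \<Rightarrow> bool" where
  "span_iso C \<mu> \<mu>' \<longleftrightarrow>
     (\<exists>\<phi> \<in> hom C (Dom C (fst \<mu>)) (Dom C (fst \<mu>')). iso C \<phi> \<and>
        fst \<mu>' \<cdot>\<^bsub>C\<^esub> \<phi> = fst \<mu> \<and> snd \<mu>' \<cdot>\<^bsub>C\<^esub> \<phi> = snd \<mu>)"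

text \<open>The pair \<open>(m\<^sub>1, m\<^sub>2)\<close> of consecutive matches and the match \<open>n\<close> of the composite belong to
  one and the same diagram: the derivation of \<open>r\<^sub>1\<close> at \<open>m\<^sub>1\<close>, with context object \<open>L\<^sub>1\<close>, factors
  through the span \<open>N\<^sub>2\<^sub>1 \<leftarrow> K\<^sub>1' \<rightarrow> I\<^sub>2\<^sub>1\<close> by means of vertical morphisms \<open>h : N\<^sub>2\<^sub>1 \<rightarrow> X\<^sub>1\<close>,
  \<open>k : K\<^sub>1' \<rightarrow> L\<^sub>1\<close> and \<open>n : I\<^sub>2\<^sub>1 \<rightarrow> X\<^sub>0\<close>, and \<open>h\<close> restricts to \<open>m\<^sub>2\<close> on \<open>I\<^sub>2\<close>.
  This is the relation with respect to which the matches determine each other; an isomorphism of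
  the resulting objects alone does not determine them, as different matches may well have
  isomorphic results.\<close>

definition same_diagram ::
  "('o, 'm) category_data \<Rightarrow> 'm \<times> 'm \<Rightarrow> ('m, 'i) rule \<Rightarrow> 'm \<Rightarrow> 'm \<Rightarrow> 'm \<Rightarrow> bool" where
  "same_diagram C \<mu> R1 m1 m2 n \<longleftrightarrow>
     (\<exists>h \<in> hom C (Cod C (snd (comp_union C \<mu>))) (rewrite C R1 m1).
      \<exists>k \<in> hom C (Cod C (fst (comp_poc1 C \<mu> R1))) (Cod C (fst (sqpo_fpc C R1 m1))).
        n \<cdot>\<^bsub>C\<^esub> fst (comp_in C \<mu> R1) = m1 \<and>
        n \<cdot>\<^bsub>C\<^esub> snd (comp_in C \<mu> R1) = snd (sqpo_fpc C R1 m1) \<cdot>\<^bsub>C\<^esub> k \<and>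
        h \<cdot>\<^bsub>C\<^esub> snd (comp_poc1 C \<mu> R1) = snd (sqpo_pushout C R1 m1) \<cdot>\<^bsub>C\<^esub> k \<and>
        h \<cdot>\<^bsub>C\<^esub> snd (comp_union C \<mu>) = fst (sqpo_pushout C R1 m1) \<and>
        h \<cdot>\<^bsub>C\<^esub> fst (comp_union C \<mu>) = m2)"

end

theory Submission
  imports Defs
begin

text \<open>
  Pushouts of \<open>M\<close>-morphisms are final pullback complements, and final pullback complements can be
  cancelled: if \<open>K \<rightarrow> D \<rightarrow> J\<close> is one of \<open>K \<rightarrow> I \<rightarrow> J\<close> and \<open>K \<rightarrow> L \<rightarrow> X\<close> is one of
  \<open>K \<rightarrow> I \<rightarrow> J \<rightarrow> X\<close>, then \<open>D \<rightarrow> L \<rightarrow> X\<close> is one of \<open>D \<rightarrow> J \<rightarrow> X\<close>. Consider a derivation with match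
  \<open>n : I \<rightarrow> X\<close> and comatch \<open>h : O \<rightarrow> Y\<close>, and the pushouts \<open>I'\<close> and \<open>O'\<close> of the rule along some
  \<open>K \<rightarrow> K'\<close>. Then \<open>n\<close> factors through \<open>I'\<close> if and only if \<open>h\<close> factors through \<open>O'\<close>, the
  factorizations correspond to each other, and they are the match and the comatch of a derivation
  of the extended rule. Used recursively, this shows that \<open>Trans\<close> is compatible with SqPO
  derivations. Used for \<open>O\<^sub>1 \<rightarrow> N\<^sub>2\<^sub>1\<close>, it translates between pairs \<open>(m\<^sub>1, m\<^sub>2)\<close> and matches \<open>n\<close> of
  the composite. The overlap belonging to \<open>(m\<^sub>1, m\<^sub>2)\<close> is the pullback of \<open>m\<^sub>2\<close> and the comatch of
  \<open>m\<^sub>1\<close>; its pushout \<open>N\<^sub>2\<^sub>1\<close> embeds into \<open>X\<^sub>1\<close> by effective unions.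
\<close>

section \<open>Pasting and cancelling squares\<close>

lemma comm_squareD:
  assumes "comm_square C f g h k"
  shows "f \<in> Arr C" "g \<in> Arr C" "h \<in> Arr C" "k \<in> Arr C"
    "Dom C f = Dom C g" "Cod C f = Dom C h" "Cod C g = Dom C k" "Cod C h = Cod C k"
    "h \<cdot>\<^bsub>C\<^esub> f = k \<cdot>\<^bsub>C\<^esub> g"
  using assms by (auto simp: comm_square_def)

lemma comm_square_sym: "comm_square C f g h k \<longleftrightarrow> comm_square C g f k h"
  by (auto simp: comm_square_def)

lemma pushout_comm: "pushout C f g h k \<Longrightarrow> comm_square C f g h k"
  by (simp add: pushout_def)

lemma pullback_comm: "pullback C f g h k \<Longrightarrow> comm_square C f g h k"
  by (simp add: pullback_def)

lemma fpc_pullback: "fpc C a c b d \<Longrightarrow> pullback C a b c d"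
  by (simp add: fpc_def)

lemmas pushoutD = comm_squareD[OF pushout_comm]
lemmas pullbackD = comm_squareD[OF pullback_comm]
lemmas fpcD = pullbackD[OF fpc_pullback]

lemma pushout_sym: "pushout C f g h k \<Longrightarrow> pushout C g f k h"
  unfolding pushout_def using comm_square_sym
  by (metis comm_squareD(8))

lemma pullback_sym: "pullback C f g h k \<Longrightarrow> pullback C g f k h"
  unfolding pullback_def using comm_square_sym
  by (metis comm_squareD(5))

section \<open>Mediating morphisms, with domains and codomains made explicit\<close>

lemma pushout_induce:
  assumes "pushout C f g h k" "h \<in> hom C B E" "k \<in> hom C D E"
    and "x \<in> hom C B Y" "y \<in> hom C D Y" "x \<cdot>\<^bsub>C\<^esub> f = y \<cdot>\<^bsub>C\<^esub> g"
  obtains u where "u \<in> hom C E Y" "u \<cdot>\<^bsub>C\<^esub> h = x" "u \<cdot>\<^bsub>C\<^esub> k = y"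
proof -
  have "comm_square C f g x y"
    using assms pushoutD[OF assms(1)] by (auto simp: comm_square_def hom_def)
  then have "\<exists>!u. u \<in> hom C (Cod C h) (Cod C x) \<and> u \<cdot>\<^bsub>C\<^esub> h = x \<and> u \<cdot>\<^bsub>C\<^esub> k = y"
    using assms(1) unfolding pushout_def by blast
  then show thesis
    using that assms by (auto simp: hom_def)
qed

lemma pullback_induce:
  assumes "pullback C f g h k" "f \<in> hom C A B" "g \<in> hom C A D"
    and "x \<in> hom C Y B" "y \<in> hom C Y D" "h \<cdot>\<^bsub>C\<^esub> x = k \<cdot>\<^bsub>C\<^esub> y"
  obtains u where "u \<in> hom C Y A" "f \<cdot>\<^bsub>C\<^esub> u = x" "g \<cdot>\<^bsub>C\<^esub> u = y"
proof -
  have "comm_square C x y h k"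
    using assms pullbackD[OF assms(1)] by (auto simp: comm_square_def hom_def)
  then have "\<exists>!u. u \<in> hom C (Dom C x) (Dom C f) \<and> f \<cdot>\<^bsub>C\<^esub> u = x \<and> g \<cdot>\<^bsub>C\<^esub> u = y"
    using assms(1) unfolding pullback_def by blast
  then show thesis
    using that assms by (auto simp: hom_def)
qed

lemma fpc_induce:
  assumes "fpc C a c b d" "b \<in> hom C A D" "pullback C x y c z"
    and "y \<in> hom C P Q" "w \<in> hom C P A" "a \<cdot>\<^bsub>C\<^esub> w = x"
  obtains u where "u \<in> hom C Q D" "d \<cdot>\<^bsub>C\<^esub> u = z" "u \<cdot>\<^bsub>C\<^esub> y = b \<cdot>\<^bsub>C\<^esub> w"
proof -
  have "w \<in> hom C (Dom C x) (Dom C a)"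
    using assms fpcD[OF assms(1)] pullbackD[OF assms(3)] by (simp add: hom_def)
  then have "\<exists>!u. u \<in> hom C (Cod C y) (Cod C b) \<and> d \<cdot>\<^bsub>C\<^esub> u = z \<and> u \<cdot>\<^bsub>C\<^esub> y = b \<cdot>\<^bsub>C\<^esub> w"
    using assms unfolding fpc_def by blast
  then show thesis
    using that assms by (auto simp: hom_def)
qed

lemma monoD:
  assumes "mono C m" "m \<in> hom C B E" "u \<in> hom C A B" "v \<in> hom C A B"
    "m \<cdot>\<^bsub>C\<^esub> u = m \<cdot>\<^bsub>C\<^esub> v"
  shows "u = v"
  using assms by (auto simp: mono_def hom_def)

context category
begin

lemma hom_iff [simp]: "f \<in> hom C A B \<longleftrightarrow> f \<in> Arr C \<and> Dom C f = A \<and> Cod C f = B"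
  by (simp add: hom_def)

lemma Comp_simps [simp]:
  assumes "f \<in> Arr C" "g \<in> Arr C" "Cod C f = Dom C g"
  shows "g \<cdot> f \<in> Arr C" "Dom C (g \<cdot> f) = Dom C f" "Cod C (g \<cdot> f) = Cod C g"
  using Comp_in_hom[of f "Dom C f" "Cod C f" g "Cod C g"] assms by auto

lemma Ident_simps [simp]:
  assumes "X \<in> Obj C"
  shows "Ident C X \<in> Arr C" "Dom C (Ident C X) = X" "Cod C (Ident C X) = X"
  using Ident_in_hom[OF assms] by auto

lemma Comp_assoc_simp [simp]:
  assumes "f \<in> Arr C" "g \<in> Arr C" "h \<in> Arr C" "Cod C f = Dom C g" "Cod C g = Dom C h"
  shows "(h \<cdot> g) \<cdot> f = h \<cdot> (g \<cdot> f)"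
  using assms Comp_assoc[of f "Dom C f" "Cod C f" g "Cod C g" h "Cod C h"] by auto

lemma Ident_Comp_simps [simp]:
  assumes "f \<in> Arr C"
  shows "Dom C f = X \<Longrightarrow> f \<cdot> Ident C X = f" "Cod C f = X \<Longrightarrow> Ident C X \<cdot> f = f"
  using assms Ident_right Ident_left by auto

declare Dom_in_Obj [simp] Cod_in_Obj [simp]

lemma hom_Obj: "f \<in> hom C A B \<Longrightarrow> A \<in> Obj C \<and> B \<in> Obj C"
  by auto

text \<open>The simplifier associates composites to the right, so that \<open>g \<cdot> f\<close> no
  longer occurs literally in \<open>g \<cdot> (f \<cdot> x)\<close>. This form, like
  \<open>Comp_eq\<close> below, makes an equation between composites usable there.\<close>

lemma Comp_eq_Comp:
  assumes "g \<cdot> f = k \<cdot> h" "x \<in> Arr C" "f \<in> Arr C" "g \<in> Arr C" "h \<in> Arr C" "k \<in> Arr C"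
    "Cod C x = Dom C f" "Cod C f = Dom C g" "Cod C x = Dom C h" "Cod C h = Dom C k"
  shows "g \<cdot> (f \<cdot> x) = k \<cdot> (h \<cdot> x)"
  using assms by (metis Comp_assoc_simp)

lemma Comp_eq:
  assumes "g \<cdot> f = k" "x \<in> Arr C" "f \<in> Arr C" "g \<in> Arr C"
    "Cod C x = Dom C f" "Cod C f = Dom C g"
  shows "g \<cdot> (f \<cdot> x) = k \<cdot> x"
  using assms by (metis Comp_assoc_simp)

lemma pushout_unique:
  assumes p: "pushout C f g h k" and ty: "h \<in> hom C B E" "k \<in> hom C D E"
    and u: "u \<in> hom C E Y" and v: "v \<in> hom C E Y"
    and eq: "u \<cdot> h = v \<cdot> h" "u \<cdot> k = v \<cdot> k"
  shows "u = v"
proof -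
  have "f \<in> hom C (Dom C f) B" "g \<in> hom C (Dom C f) D"
    using pushoutD[OF p] ty by (auto simp: hom_def)
  moreover have "h \<cdot> f = k \<cdot> g"
    using pushoutD[OF p] by simp
  ultimately have "(u \<cdot> h) \<cdot> f = (u \<cdot> k) \<cdot> g"
    using ty u by (metis Comp_assoc)
  moreover have "u \<cdot> h \<in> hom C B Y" "u \<cdot> k \<in> hom C D Y"
    using ty u by (auto intro: Comp_in_hom)
  ultimately have "comm_square C f g (u \<cdot> h) (u \<cdot> k)"
    using pushoutD[OF p] ty by (auto simp: comm_square_def hom_def)
  then have "\<exists>!w. w \<in> hom C (Cod C h) (Cod C (u \<cdot> h)) \<and> w \<cdot> h = u \<cdot> h \<and> w \<cdot> k = u \<cdot> k"
    using p unfolding pushout_def by blast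
  moreover have "Cod C h = E" "Cod C (u \<cdot> h) = Y"
    using ty \<open>u \<cdot> h \<in> hom C B Y\<close> by (auto simp: hom_def)
  ultimately show ?thesis
    using eq u v by metis
qed

lemma pullback_unique:
  assumes p: "pullback C f g h k" and ty: "f \<in> hom C A B" "g \<in> hom C A D"
    and u: "u \<in> hom C Y A" and v: "v \<in> hom C Y A"
    and eq: "f \<cdot> u = f \<cdot> v" "g \<cdot> u = g \<cdot> v"
  shows "u = v"
proof -
  have "h \<in> hom C B (Cod C h)" "k \<in> hom C D (Cod C h)"
    using pullbackD[OF p] ty by (auto simp: hom_def)
  moreover have "h \<cdot> f = k \<cdot> g"
    using pullbackD[OF p] by simp
  ultimately have "h \<cdot> (f \<cdot> u) = k \<cdot> (g \<cdot> u)"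
    using ty u by - (rule Comp_eq_Comp, auto)
  moreover have "f \<cdot> u \<in> hom C Y B" "g \<cdot> u \<in> hom C Y D"
    using ty u by (auto intro: Comp_in_hom)
  ultimately have "comm_square C (f \<cdot> u) (g \<cdot> u) h k"
    using pullbackD[OF p] ty by (auto simp: comm_square_def hom_def)
  then have "\<exists>!w. w \<in> hom C (Dom C (f \<cdot> u)) (Dom C f) \<and> f \<cdot> w = f \<cdot> u \<and> g \<cdot> w = g \<cdot> u"
    using p unfolding pullback_def by blast
  moreover have "Dom C f = A" "Dom C (f \<cdot> u) = Y"
    using ty \<open>f \<cdot> u \<in> hom C Y B\<close> by (auto simp: hom_def)
  ultimately show ?thesis
    using eq u v by metis
qed

lemma comm_squareI:
  assumes "f \<in> hom C A B" "g \<in> hom C A D" "h \<in> hom C B E" "k \<in> hom C D E" "h \<cdot> f = k \<cdot> g"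
  shows "comm_square C f g h k"
  using assms by (simp add: comm_square_def)

lemma pullbackI:
  assumes "f \<in> hom C A B" "g \<in> hom C A D" "h \<in> hom C B E" "k \<in> hom C D E" "h \<cdot> f = k \<cdot> g"
    and ex: "\<And>P x y. x \<in> hom C P B \<Longrightarrow> y \<in> hom C P D \<Longrightarrow> h \<cdot> x = k \<cdot> y \<Longrightarrow>
      \<exists>u \<in> hom C P A. f \<cdot> u = x \<and> g \<cdot> u = y"
    and uniq: "\<And>P u v. u \<in> hom C P A \<Longrightarrow> v \<in> hom C P A \<Longrightarrow> f \<cdot> u = f \<cdot> v \<Longrightarrow> g \<cdot> u = g \<cdot> v \<Longrightarrow> u = v"
  shows "pullback C f g h k"
  unfolding pullback_def
proof (intro conjI allI impI comm_squareI[OF assms(1-5)])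
  fix x y assume "comm_square C x y h k"
  note d = comm_squareD[OF this]
  have xy: "x \<in> hom C (Dom C x) B" "y \<in> hom C (Dom C x) D"
    using assms(1-4) d(1-8) by simp_all
  obtain u where "u \<in> hom C (Dom C x) A" "f \<cdot> u = x" "g \<cdot> u = y"
    using ex[OF xy d(9)] by blast
  then show "\<exists>!u. u \<in> hom C (Dom C x) (Dom C f) \<and> f \<cdot> u = x \<and> g \<cdot> u = y"
    using assms(1-4) by (intro ex1I[of _ u]) (auto intro!: uniq)
qed

lemma pushoutI:
  assumes "f \<in> hom C A B" "g \<in> hom C A D" "h \<in> hom C B E" "k \<in> hom C D E" "h \<cdot> f = k \<cdot> g"
    and ex: "\<And>P x y. x \<in> hom C B P \<Longrightarrow> y \<in> hom C D P \<Longrightarrow> x \<cdot> f = y \<cdot> g \<Longrightarrow>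
      \<exists>u \<in> hom C E P. u \<cdot> h = x \<and> u \<cdot> k = y"
    and uniq: "\<And>P u v. u \<in> hom C E P \<Longrightarrow> v \<in> hom C E P \<Longrightarrow> u \<cdot> h = v \<cdot> h \<Longrightarrow> u \<cdot> k = v \<cdot> k \<Longrightarrow> u = v"
  shows "pushout C f g h k"
  unfolding pushout_def
proof (intro conjI allI impI comm_squareI[OF assms(1-5)])
  fix x y assume "comm_square C f g x y"
  note d = comm_squareD[OF this]
  have xy: "x \<in> hom C B (Cod C x)" "y \<in> hom C D (Cod C x)"
    using assms(1-4) d(1-8) by simp_all
  obtain u where "u \<in> hom C E (Cod C x)" "u \<cdot> h = x" "u \<cdot> k = y"
    using ex[OF xy d(9)] by blast
  then show "\<exists>!u. u \<in> hom C (Cod C h) (Cod C x) \<and> u \<cdot> h = x \<and> u \<cdot> k = y"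
    using assms(1-4) by (intro ex1I[of _ u]) (auto intro!: uniq)
qed

section \<open>Pasting and cancellation of pullbacks and of pushouts\<close>

lemma pullback_paste:
  assumes l: "pullback C f g h k" and r: "pullback C f' h h' k'"
  shows "pullback C (f' \<cdot> f) g h' (k' \<cdot> k)"
proof -
  obtain A B D E B' E' where ty: "f \<in> hom C A B" "g \<in> hom C A D" "h \<in> hom C B E" "k \<in> hom C D E"
    "f' \<in> hom C B B'" "h' \<in> hom C B' E'" "k' \<in> hom C E E'"
    by (rule that) (use pullbackD(1-8)[OF l] pullbackD(1-8)[OF r] in auto)
  note eq = Comp_eq_Comp[OF pullbackD(9)[OF l]] Comp_eq_Comp[OF pullbackD(9)[OF r]]
  show ?thesis
  proof (rule pullbackI)
    show "f' \<cdot> f \<in> hom C A B'" "g \<in> hom C A D" "h' \<in> hom C B' E'" "k' \<cdot> k \<in> hom C D E'"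
      using ty by simp_all
    show "h' \<cdot> (f' \<cdot> f) = (k' \<cdot> k) \<cdot> g"
      using ty by (simp add: eq pullbackD(9)[OF l])
    fix P x y assume xy: "x \<in> hom C P B'" "y \<in> hom C P D" "h' \<cdot> x = (k' \<cdot> k) \<cdot> y"
    obtain u where u: "u \<in> hom C P B" "f' \<cdot> u = x" "h \<cdot> u = k \<cdot> y"
      by (rule pullback_induce[OF r ty(5,3) xy(1), of "k \<cdot> y"]) (use xy ty in simp_all)
    obtain v where v: "v \<in> hom C P A" "f \<cdot> v = u" "g \<cdot> v = y"
      using pullback_induce[OF l ty(1,2) u(1) xy(2) u(3)] .
    show "\<exists>v \<in> hom C P A. (f' \<cdot> f) \<cdot> v = x \<and> g \<cdot> v = y"
      using u v ty by (intro bexI[of _ v]) simp_all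
  next
    fix P u v assume uv: "u \<in> hom C P A" "v \<in> hom C P A"
      "(f' \<cdot> f) \<cdot> u = (f' \<cdot> f) \<cdot> v" "g \<cdot> u = g \<cdot> v"
    have "f \<cdot> u = f \<cdot> v"
      using uv ty by - (rule pullback_unique[OF r ty(5,3), of _ P], simp_all add: eq)
    then show "u = v"
      using pullback_unique[OF l ty(1,2) uv(1,2)] uv by simp
  qed
qed

lemma pullback_cancel:
  assumes b: "pullback C (f' \<cdot> f) g h' (k' \<cdot> k)" and r: "pullback C f' h h' k'"
    and l: "comm_square C f g h k"
  shows "pullback C f g h k"
proof -
  obtain A B D E B' E' where ty: "f \<in> hom C A B" "g \<in> hom C A D" "h \<in> hom C B E" "k \<in> hom C D E"
    "f' \<in> hom C B B'" "h' \<in> hom C B' E'" "k' \<in> hom C E E'"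
    by (rule that) (use comm_squareD(1-8)[OF l] pullbackD(1-8)[OF r] in auto)
  note eq = Comp_eq_Comp[OF comm_squareD(9)[OF l]] Comp_eq_Comp[OF pullbackD(9)[OF r]]
  have f'f: "f' \<cdot> f \<in> hom C A B'"
    using ty by simp
  show ?thesis
  proof (rule pullbackI[OF ty(1-4)])
    show "h \<cdot> f = k \<cdot> g"
      using comm_squareD(9)[OF l] .
    fix P x y assume xy: "x \<in> hom C P B" "y \<in> hom C P D" "h \<cdot> x = k \<cdot> y"
    obtain u where u: "u \<in> hom C P A" "(f' \<cdot> f) \<cdot> u = f' \<cdot> x" "g \<cdot> u = y"
      by (rule pullback_induce[OF b f'f ty(2), of "f' \<cdot> x" P y]) (use xy ty in \<open>simp_all add: eq\<close>)
    have "f \<cdot> u = x"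
      using u ty xy by - (rule pullback_unique[OF r ty(5,3), of _ P], simp_all add: eq)
    then show "\<exists>u \<in> hom C P A. f \<cdot> u = x \<and> g \<cdot> u = y"
      using u by auto
  next
    fix P u v assume uv: "u \<in> hom C P A" "v \<in> hom C P A" "f \<cdot> u = f \<cdot> v" "g \<cdot> u = g \<cdot> v"
    then show "u = v"
      using ty by - (rule pullback_unique[OF b f'f ty(2) uv(1,2)], simp_all)
  qed
qed

lemma pushout_paste:
  assumes l: "pushout C f g h k" and r: "pushout C f' h h' k'"
  shows "pushout C (f' \<cdot> f) g h' (k' \<cdot> k)"
proof -
  obtain A B D E B' E' where ty: "f \<in> hom C A B" "g \<in> hom C A D" "h \<in> hom C B E" "k \<in> hom C D E"
    "f' \<in> hom C B B'" "h' \<in> hom C B' E'" "k' \<in> hom C E E'"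
    by (rule that) (use pushoutD(1-8)[OF l] pushoutD(1-8)[OF r] in auto)
  note eq = Comp_eq_Comp[OF pushoutD(9)[OF l]] Comp_eq_Comp[OF pushoutD(9)[OF r]]
  show ?thesis
  proof (rule pushoutI)
    show "f' \<cdot> f \<in> hom C A B'" "g \<in> hom C A D" "h' \<in> hom C B' E'" "k' \<cdot> k \<in> hom C D E'"
      using ty by simp_all
    show "h' \<cdot> (f' \<cdot> f) = (k' \<cdot> k) \<cdot> g"
      using ty by (simp add: eq pushoutD(9)[OF l])
    fix P x y assume xy: "x \<in> hom C B' P" "y \<in> hom C D P" "x \<cdot> (f' \<cdot> f) = y \<cdot> g"
    obtain u where u: "u \<in> hom C E P" "u \<cdot> h = x \<cdot> f'" "u \<cdot> k = y"
      by (rule pushout_induce[OF l ty(3,4), of "x \<cdot> f'" P y]) (use xy ty in simp_all)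
    obtain v where v: "v \<in> hom C E' P" "v \<cdot> h' = x" "v \<cdot> k' = u"
      using pushout_induce[OF r ty(6,7) xy(1) u(1) u(2)[symmetric]] .
    show "\<exists>v \<in> hom C E' P. v \<cdot> h' = x \<and> v \<cdot> (k' \<cdot> k) = y"
      using u v ty by (intro bexI[of _ v]) (simp_all add: Comp_eq)
  next
    fix P u v assume uv: "u \<in> hom C E' P" "v \<in> hom C E' P"
      "u \<cdot> h' = v \<cdot> h'" "u \<cdot> (k' \<cdot> k) = v \<cdot> (k' \<cdot> k)"
    have "u \<cdot> (k' \<cdot> h) = v \<cdot> (k' \<cdot> h)"
      using uv ty Comp_eq_Comp[OF uv(3), of f'] by (simp add: pushoutD(9)[OF r, symmetric])
    then have "u \<cdot> k' = v \<cdot> k'"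
      using uv ty by - (rule pushout_unique[OF l ty(3,4), of _ P], simp_all)
    then show "u = v"
      using pushout_unique[OF r ty(6,7) uv(1,2)] uv by simp
  qed
qed

lemma pushout_cancel:
  assumes b: "pushout C (f' \<cdot> f) g h' (k' \<cdot> k)" and l: "pushout C f g h k"
    and r: "comm_square C f' h h' k'"
  shows "pushout C f' h h' k'"
proof -
  obtain A B D E B' E' where ty: "f \<in> hom C A B" "g \<in> hom C A D" "h \<in> hom C B E" "k \<in> hom C D E"
    "f' \<in> hom C B B'" "h' \<in> hom C B' E'" "k' \<in> hom C E E'"
    by (rule that) (use pushoutD(1-8)[OF l] comm_squareD(1-8)[OF r] in auto)
  note eq = pushoutD(9)[OF l] comm_squareD(9)[OF r]
  have kk: "k' \<cdot> k \<in> hom C D E'"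
    using ty by simp
  show ?thesis
  proof (rule pushoutI[OF ty(5,3,6,7) eq(2)])
    fix P x y assume xy: "x \<in> hom C B' P" "y \<in> hom C E P" "x \<cdot> f' = y \<cdot> h"
    obtain u where u: "u \<in> hom C E' P" "u \<cdot> h' = x" "u \<cdot> (k' \<cdot> k) = y \<cdot> k"
      by (rule pushout_induce[OF b ty(6) kk, of x P "y \<cdot> k"])
        (use xy ty in \<open>simp_all add: Comp_eq_Comp[OF xy(3)] eq\<close>)
    have "u \<cdot> (k' \<cdot> h) = x \<cdot> f'"
      using u(1) ty Comp_eq[OF u(2), of f'] by (simp add: eq)
    then have "u \<cdot> k' = y"
      using u(1,3) ty xy by - (rule pushout_unique[OF l ty(3,4), of _ P], simp_all)
    then show "\<exists>u \<in> hom C E' P. u \<cdot> h' = x \<and> u \<cdot> k' = y"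
      using u by auto
  next
    fix P u v assume uv: "u \<in> hom C E' P" "v \<in> hom C E' P" "u \<cdot> h' = v \<cdot> h'" "u \<cdot> k' = v \<cdot> k'"
    then show "u = v"
      using ty Comp_eq_Comp[OF uv(4), of k]
      by - (rule pushout_unique[OF b ty(6) kk uv(1,2)], simp_all)
  qed
qed

section \<open>Pullbacks and monomorphisms\<close>

lemma mono_Arr: "mono C m \<Longrightarrow> m \<in> Arr C"
  by (simp add: mono_def)

text \<open>If \<open>m \<cdot> x = m \<cdot> f \<cdot> y\<close>, cancelling \<open>m\<close> shows
  that \<open>y\<close> itself is the mediating morphism. Squares of this degenerate shape serve as
  side faces of van Kampen cubes.\<close>

lemma pullback_mono_Ident:
  assumes m: "mono C m" "m \<in> hom C B E" and f: "f \<in> hom C A B"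
  shows "pullback C f (Ident C A) m (m \<cdot> f)"
proof -
  have A: "A \<in> Obj C"
    using hom_Obj[OF f] ..
  show ?thesis
  proof (rule pullbackI)
    show "f \<in> hom C A B" "Ident C A \<in> hom C A A" "m \<in> hom C B E" "m \<cdot> f \<in> hom C A E"
      using A m f by simp_all
    show "m \<cdot> f = (m \<cdot> f) \<cdot> Ident C A"
      using A m f by simp
    fix P x y assume xy: "x \<in> hom C P B" "y \<in> hom C P A" "m \<cdot> x = (m \<cdot> f) \<cdot> y"
    have "f \<cdot> y = x"
      using xy m f by - (rule monoD[OF m, of _ P], simp_all)
    then show "\<exists>u \<in> hom C P A. f \<cdot> u = x \<and> Ident C A \<cdot> u = y"
      using xy by auto
  qed auto
qed

lemma pullback_Comp_mono:
  assumes p: "pullback C f g h k" and m: "mono C m" "Dom C m = Cod C h"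
  shows "pullback C f g (m \<cdot> h) (m \<cdot> k)"
proof -
  obtain A B D E F where ty: "f \<in> hom C A B" "g \<in> hom C A D" "h \<in> hom C B E" "k \<in> hom C D E"
    "m \<in> hom C E F"
    by (rule that) (use pullbackD(1-8)[OF p] m mono_Arr[OF m(1)] in auto)
  show ?thesis
  proof (rule pullbackI[OF ty(1,2)])
    show "m \<cdot> h \<in> hom C B F" "m \<cdot> k \<in> hom C D F"
      using ty by auto
    show "(m \<cdot> h) \<cdot> f = (m \<cdot> k) \<cdot> g"
      using ty pullbackD(9)[OF p] by simp
    fix P x y assume xy: "x \<in> hom C P B" "y \<in> hom C P D" "(m \<cdot> h) \<cdot> x = (m \<cdot> k) \<cdot> y"
    have "h \<cdot> x = k \<cdot> y"
      using xy ty by - (rule monoD[OF m(1) ty(5), of _ P], simp_all)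
    from pullback_induce[OF p ty(1,2) xy(1,2) this]
    show "\<exists>u \<in> hom C P A. f \<cdot> u = x \<and> g \<cdot> u = y"
      by metis
  qed (fact pullback_unique[OF p ty(1,2)])
qed

text \<open>The given pullback turns a test pair \<open>x\<close>, \<open>u \<cdot> y\<close> into
  some \<open>v\<close> with \<open>u \<cdot> g \<cdot> v = u \<cdot> y\<close>, and
  \<open>u\<close> cancels. It is used to restrict a pullback to a subobject of one corner, in the
  form required by effective unions.\<close>

lemma pullback_precomp_mono:
  assumes p: "pullback C f (u \<cdot> g) h k" and u: "mono C u" and g: "g \<in> Arr C" "Cod C g = Dom C u"
  shows "pullback C f g h (k \<cdot> u)"
proof -
  note uA = mono_Arr[OF u]
  obtain A B D F E where ty: "f \<in> hom C A B" "g \<in> hom C A D" "u \<in> hom C D F"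
    "h \<in> hom C B E" "k \<in> hom C F E"
    by (rule that) (use pullbackD(1-8)[OF p] g uA in auto)
  have ug: "u \<cdot> g \<in> hom C A F"
    using ty by simp
  show ?thesis
  proof (rule pullbackI[OF ty(1,2,4)])
    show "k \<cdot> u \<in> hom C D E"
      using ty by simp
    show "h \<cdot> f = (k \<cdot> u) \<cdot> g"
      using ty pullbackD(9)[OF p] by simp
    fix P x y assume xy: "x \<in> hom C P B" "y \<in> hom C P D" "h \<cdot> x = (k \<cdot> u) \<cdot> y"
    obtain v where v: "v \<in> hom C P A" "f \<cdot> v = x" "(u \<cdot> g) \<cdot> v = u \<cdot> y"
      by (rule pullback_induce[OF p ty(1) ug xy(1), of "u \<cdot> y"]) (use xy ty in simp_all)
    have "g \<cdot> v = y"
      using v xy ty by - (rule monoD[OF u ty(3), of _ P], simp_all)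
    then show "\<exists>v \<in> hom C P A. f \<cdot> v = x \<and> g \<cdot> v = y"
      using v by auto
  next
    fix P x y assume xy: "x \<in> hom C P A" "y \<in> hom C P A" "f \<cdot> x = f \<cdot> y" "g \<cdot> x = g \<cdot> y"
    then show "x = y"
      using ty by - (rule pullback_unique[OF p ty(1) ug xy(1,2)], simp_all)
  qed
qed

text \<open>Cancelling the monomorphism \<open>d\<close> yields the uniqueness of \<open>u\<close>
  and also \<open>u \<cdot> y = b \<cdot> w\<close>, because \<open>d \<cdot> u \<cdot> y = z
  \<cdot> y = c \<cdot> x = c \<cdot> a \<cdot> w = d \<cdot> b \<cdot> w\<close>.\<close>

lemma fpcI:
  assumes p: "pullback C a b c d" and ty: "a \<in> hom C A B" "b \<in> hom C A D" "c \<in> hom C B E"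
    and m: "mono C d"
    and ex: "\<And>P Q x y z w. pullback C x y c z \<Longrightarrow> x \<in> hom C P B \<Longrightarrow> y \<in> hom C P Q \<Longrightarrow>
      z \<in> hom C Q E \<Longrightarrow> w \<in> hom C P A \<Longrightarrow> a \<cdot> w = x \<Longrightarrow> \<exists>u \<in> hom C Q D. d \<cdot> u = z"
  shows "fpc C a c b d"
  unfolding fpc_def
proof (intro conjI allI impI p)
  fix x y z w
  assume xy: "pullback C x y c z" and w: "w \<in> hom C (Dom C x) (Dom C a)" and eq: "a \<cdot> w = x"
  obtain P Q where ty': "x \<in> hom C P B" "y \<in> hom C P Q" "z \<in> hom C Q E" "w \<in> hom C P A"
      "d \<in> hom C D E"
    by (rule that) (use pullbackD(1-8)[OF xy] pullbackD(1-8)[OF p] ty w in auto)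
  obtain u where u: "u \<in> hom C Q D" "d \<cdot> u = z"
    using ex[OF xy ty'(1-4) eq] by blast
  have "d \<cdot> (u \<cdot> y) = c \<cdot> x"
    using u ty ty' pullbackD(9)[OF xy] by (simp add: Comp_eq)
  also have "\<dots> = d \<cdot> (b \<cdot> w)"
    using ty ty' eq Comp_eq_Comp[OF pullbackD(9)[OF p], of w] by auto
  finally have uy: "u \<cdot> y = b \<cdot> w"
    using u ty ty' by - (rule monoD[OF m ty'(5), of _ P], auto)
  show "\<exists>!u. u \<in> hom C (Cod C y) (Cod C b) \<and> d \<cdot> u = z \<and> u \<cdot> y = b \<cdot> w"
  proof (rule ex1I[of _ u])
    show "u \<in> hom C (Cod C y) (Cod C b) \<and> d \<cdot> u = z \<and> u \<cdot> y = b \<cdot> w"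
      using u uy ty ty' by simp
    fix v assume "v \<in> hom C (Cod C y) (Cod C b) \<and> d \<cdot> v = z \<and> v \<cdot> y = b \<cdot> w"
    then show "v = u"
      using u ty ty' by - (rule monoD[OF m ty'(5), of _ Q], auto)
  qed
qed

section \<open>Isomorphisms, and uniqueness of universal constructions\<close>

lemma isoE:
  assumes "iso C f" "f \<in> hom C A B"
  obtains g where "g \<in> hom C B A" "iso C g" "g \<cdot> f = Ident C A" "f \<cdot> g = Ident C B"
proof -
  obtain g where g: "f \<in> Arr C" "g \<in> hom C (Cod C f) (Dom C f)"
    "g \<cdot> f = Ident C (Dom C f)" "f \<cdot> g = Ident C (Cod C f)"
    using assms by (auto simp: iso_def)
  moreover have "iso C g"
    using g unfolding iso_def by (auto intro!: bexI[of _ f])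
  ultimately show thesis
    using that assms by auto
qed

lemma isoI:
  assumes "f \<in> hom C A B" "g \<in> hom C B A" "g \<cdot> f = Ident C A" "f \<cdot> g = Ident C B"
  shows "iso C f"
  using assms unfolding iso_def by (auto intro!: bexI[of _ g])

lemma iso_Ident: "X \<in> Obj C \<Longrightarrow> iso C (Ident C X)"
  by (rule isoI[of _ X X "Ident C X"]) simp_all

lemma isomorphic_sym:
  assumes "isomorphic C X Y"
  shows "isomorphic C Y X"
proof -
  obtain \<phi> where "\<phi> \<in> hom C X Y" "iso C \<phi>"
    using assms unfolding isomorphic_def by blast
  then show ?thesis
    unfolding isomorphic_def by (blast elim: isoE)
qed

lemma pushout_Ident:
  assumes "g \<in> hom C A D"
  shows "pushout C (Ident C A) g g (Ident C D)"
proof (rule pushoutI)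
  show "Ident C A \<in> hom C A A" "g \<in> hom C A D" "g \<in> hom C A D" "Ident C D \<in> hom C D D"
    "g \<cdot> Ident C A = Ident C D \<cdot> g"
    using assms by auto
  fix P x y assume xy: "x \<in> hom C A P" "y \<in> hom C D P" "x \<cdot> Ident C A = y \<cdot> g"
  then show "\<exists>u \<in> hom C D P. u \<cdot> g = x \<and> u \<cdot> Ident C D = y"
    using assms by (intro bexI[of _ y]) auto
qed (use assms in auto)

text \<open>Commutativity reads \<open>h = k \<cdot> g\<close>, so the morphism induced by
  \<open>g\<close> and the identity of \<open>D\<close> is a two-sided inverse of
  \<open>k\<close>.\<close>

lemma pushout_Ident_iso:
  assumes p: "pushout C (Ident C A) g h k" and g: "g \<in> hom C A D"
  shows "iso C k"
proof -
  have A: "A \<in> Obj C" and D: "D \<in> Obj C"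
    using hom_Obj[OF g] by auto
  obtain E where ty: "h \<in> hom C A E" "k \<in> hom C D E"
    by (rule that) (use pushoutD(1-8)[OF p] g A in auto)
  note E = hom_Obj[OF ty(1), THEN conjunct2]
  obtain u where u: "u \<in> hom C E D" "u \<cdot> h = g" "u \<cdot> k = Ident C D"
    by (rule pushout_induce[OF p ty g, of "Ident C D"]) (use g A D in auto)
  have hk: "h = k \<cdot> g"
    using pushoutD(9)[OF p] A ty by simp
  have "k \<cdot> u = Ident C E"
    using u ty E D Comp_eq[OF u(3), of g]
    by - (rule pushout_unique[OF p ty, of _ E], simp_all add: hk)
  then show ?thesis
    using u ty by (intro isoI[of k D E u]) auto
qed

lemma pullback_isomorphic:
  assumes p: "pullback C f g h k" and q: "pullback C f' g' h k"
  obtains \<phi> where "\<phi> \<in> hom C (Dom C f) (Dom C f')" "iso C \<phi>" "f' \<cdot> \<phi> = f" "g' \<cdot> \<phi> = g"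
proof -
  obtain A B D E A' where ty: "f \<in> hom C A B" "g \<in> hom C A D" "h \<in> hom C B E" "k \<in> hom C D E"
    "f' \<in> hom C A' B" "g' \<in> hom C A' D"
    by (rule that) (use pullbackD(1-8)[OF p] pullbackD(1-8)[OF q] in auto)
  note A = hom_Obj[OF ty(1), THEN conjunct1] hom_Obj[OF ty(5), THEN conjunct1]
  obtain u where u: "u \<in> hom C A A'" "f' \<cdot> u = f" "g' \<cdot> u = g"
    using pullback_induce[OF q ty(5,6,1,2) pullbackD(9)[OF p]] .
  obtain v where v: "v \<in> hom C A' A" "f \<cdot> v = f'" "g \<cdot> v = g'"
    using pullback_induce[OF p ty(1,2,5,6) pullbackD(9)[OF q]] .
  have "v \<cdot> u = Ident C A"
    using u v ty A by - (rule pullback_unique[OF p ty(1,2), of _ A], simp_all add: Comp_eq)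
  moreover have "u \<cdot> v = Ident C A'"
    using u v ty A by - (rule pullback_unique[OF q ty(5,6), of _ A'], simp_all add: Comp_eq)
  ultimately have "iso C u"
    using u v by (intro isoI[of u A A' v]) simp_all
  then show thesis
    using that[of u] u ty by auto
qed

text \<open>Together with the uniqueness of final pullback complements, this makes the result of a
  derivation independent, up to isomorphism, of the chosen constructions.\<close>

lemma pushout_iso_complement:
  assumes p: "pushout C f g h k" and i: "iso C \<phi>" "Dom C \<phi> = Cod C g"
    and q: "pushout C f (\<phi> \<cdot> g) h' k'"
  shows "isomorphic C (Cod C h') (Cod C h)"
proof -
  have "\<phi> \<in> Arr C"
    using i by (simp add: iso_def)
  obtain A B D D' E E' where ty: "f \<in> hom C A B" "g \<in> hom C A D" "h \<in> hom C B E" "k \<in> hom C D E"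
    "\<phi> \<in> hom C D D'" "h' \<in> hom C B E'" "k' \<in> hom C D' E'"
    by (rule that) (use pushoutD(1-8)[OF p] pushoutD(1-8)[OF q] i \<open>\<phi> \<in> Arr C\<close> in auto)
  note E = hom_Obj[OF ty(3), THEN conjunct2] hom_Obj[OF ty(6), THEN conjunct2]
  obtain \<psi> where \<psi>: "\<psi> \<in> hom C D' D" "\<psi> \<cdot> \<phi> = Ident C D" "\<phi> \<cdot> \<psi> = Ident C D'"
    using isoE[OF i(1) ty(5)] .
  obtain u where u: "u \<in> hom C E' E" "u \<cdot> h' = h" "u \<cdot> k' = k \<cdot> \<psi>"
    by (rule pushout_induce[OF q ty(6,7,3), of "k \<cdot> \<psi>"])
      (use ty \<psi> pushoutD(9)[OF p] in \<open>auto simp: Comp_eq[OF \<psi>(2)]\<close>)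
  obtain v where v: "v \<in> hom C E E'" "v \<cdot> h = h'" "v \<cdot> k = k' \<cdot> \<phi>"
    by (rule pushout_induce[OF p ty(3,4,6), of "k' \<cdot> \<phi>"])
      (use ty \<psi> pushoutD(9)[OF q] in auto)
  have "v \<cdot> u = Ident C E'"
    using u v ty E \<psi>
    by - (rule pushout_unique[OF q ty(6,7), of _ E'], simp_all add: Comp_eq[OF v(3)])
  moreover have "u \<cdot> v = Ident C E"
    using u v ty E \<psi>
    by - (rule pushout_unique[OF p ty(3,4), of _ E], simp_all add: Comp_eq[OF u(3)])
  ultimately have "iso C u"
    using u v by (intro isoI[of u E' E v]) simp_all
  then show ?thesis
    using u ty unfolding isomorphic_def by auto
qed

lemma fpc_isomorphic:
  assumes p: "fpc C a c b d" "mono C d" and q: "fpc C a c b' d'" "mono C d'"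
  obtains \<phi> where "\<phi> \<in> hom C (Cod C b) (Cod C b')" "iso C \<phi>" "\<phi> \<cdot> b = b'" "d' \<cdot> \<phi> = d"
proof -
  obtain A B D D' E where ty: "a \<in> hom C A B" "b \<in> hom C A D" "c \<in> hom C B E" "d \<in> hom C D E"
    "b' \<in> hom C A D'" "d' \<in> hom C D' E"
    by (rule that) (use fpcD(1-8)[OF p(1)] fpcD(1-8)[OF q(1)] in auto)
  note A = hom_Obj[OF ty(1), THEN conjunct1]
  note D = hom_Obj[OF ty(2), THEN conjunct2] hom_Obj[OF ty(5), THEN conjunct2]
  obtain u where u: "u \<in> hom C D D'" "d' \<cdot> u = d" "u \<cdot> b = b' \<cdot> Ident C A"
    by (rule fpc_induce[OF q(1) ty(5) fpc_pullback[OF p(1)] ty(2), of "Ident C A"])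
      (use ty A in auto)
  obtain v where v: "v \<in> hom C D' D" "d \<cdot> v = d'" "v \<cdot> b' = b \<cdot> Ident C A"
    by (rule fpc_induce[OF p(1) ty(2) fpc_pullback[OF q(1)] ty(5), of "Ident C A"])
      (use ty A in auto)
  have "v \<cdot> u = Ident C D"
    using u v ty D by - (rule monoD[OF p(2) ty(4), of _ D], simp_all add: Comp_eq)
  moreover have "u \<cdot> v = Ident C D'"
    using u v ty D by - (rule monoD[OF q(2) ty(6), of _ D'], simp_all add: Comp_eq)
  ultimately have "iso C u"
    using u v by (intro isoI[of u D D' v]) simp_all
  then show thesis
    using that[of u] u ty by auto
qed

end

section \<open>Pushouts and final pullback complements in adhesive categories\<close>

context M_adhesive
begin

lemma M_Arr [simp]: "f \<in> M \<Longrightarrow> f \<in> Arr C"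
  by (simp add: M_mono mono_Arr)

lemma Ident_in_M [simp]: "X \<in> Obj C \<Longrightarrow> Ident C X \<in> M"
  by (simp add: iso_Ident iso_in_M)

lemma pushout_M': "g \<in> M \<Longrightarrow> pushout C f g h k \<Longrightarrow> h \<in> M"
  by (rule pushout_M[OF _ pushout_sym])

lemma pullback_M': "k \<in> M \<Longrightarrow> pullback C f g h k \<Longrightarrow> f \<in> M"
  by (rule pullback_M[OF _ pullback_sym])

lemma pullback_M_Ident:
  "m \<in> M \<Longrightarrow> f \<in> hom C A (Dom C m) \<Longrightarrow> pullback C f (Ident C A) m (m \<cdot> f)"
  by (rule pullback_mono_Ident) (auto simp: M_mono)

lemma van_Kampen_iff:
  assumes "f \<in> M" "pushout C f g h k" "{a, b, c, d} \<subseteq> M" "comm_square C f' g' h' k'"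
    "comm_square C h' b d h" "comm_square C k' c d k" "pullback C f' a b f" "pullback C g' a c g"
  shows "pushout C f' g' h' k' \<longleftrightarrow> pullback C h' b d h \<and> pullback C k' c d k"
  by (rule pushout_van_Kampen[OF assms(1,2), unfolded M_van_Kampen_def, rule_format,
        OF assms(3-8)])

text \<open>The direction of the van Kampen property used throughout: a pushout pulled back along an
  \<open>M\<close>-morphism stays a pushout. Commutativity of the top face is deduced from the other
  five faces by cancelling the monomorphism \<open>d\<close>.\<close>

lemma van_Kampen_pushout:
  assumes p: "pushout C f g h k" "f \<in> M" and M: "a \<in> M" "b \<in> M" "c \<in> M" "d \<in> M"
    and pb: "pullback C f' a b f" "pullback C g' a c g" "pullback C h' b d h" "pullback C k' c d k"
  shows "pushout C f' g' h' k'"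
proof -
  obtain A B D E A' B' D' E' where ty: "f \<in> hom C A B" "g \<in> hom C A D" "h \<in> hom C B E"
    "k \<in> hom C D E" "f' \<in> hom C A' B'" "g' \<in> hom C A' D'" "h' \<in> hom C B' E'"
    "k' \<in> hom C D' E'" "a \<in> hom C A' A" "b \<in> hom C B' B" "c \<in> hom C D' D" "d \<in> hom C E' E"
    by (rule that) (use pushoutD(1-8)[OF p(1)] pullbackD(1-8)[OF pb(1)] pullbackD(1-8)[OF pb(2)]
        pullbackD(1-8)[OF pb(3)] pullbackD(1-8)[OF pb(4)] in auto)
  have "d \<cdot> (h' \<cdot> f') = h \<cdot> (f \<cdot> a)"
    using ty Comp_eq_Comp[OF pullbackD(9)[OF pb(3)], of f'] pullbackD(9)[OF pb(1)] by simp
  also have "\<dots> = k \<cdot> (c \<cdot> g')"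
    using ty Comp_eq_Comp[OF pushoutD(9)[OF p(1)], of a] pullbackD(9)[OF pb(2)] by simp
  also have "\<dots> = d \<cdot> (k' \<cdot> g')"
    using ty Comp_eq_Comp[OF pullbackD(9)[OF pb(4)], of g'] by simp
  finally have "h' \<cdot> f' = k' \<cdot> g'"
    using ty by - (rule monoD[OF M_mono[OF M(4)] ty(12), of _ A'], simp_all)
  then have "comm_square C f' g' h' k'"
    using ty by - (rule comm_squareI, simp_all)
  from van_Kampen_iff[OF p(2,1) _ this pullback_comm[OF pb(3)] pullback_comm[OF pb(4)] pb(1,2)]
  show ?thesis
    using M pb by simp
qed

text \<open>The van Kampen property applies to the cube with bottom face \<open>f g h k\<close>, identities on \<open>A\<close> and
  \<open>D\<close>, and vertical arrows \<open>f\<close> over \<open>B\<close> and \<open>k\<close> over \<open>E\<close>, whose top face is trivially a pushout.\<close>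

lemma pushout_pullback:
  assumes p: "pushout C f g h k" and f: "f \<in> M"
  shows "pullback C f g h k"
proof -
  obtain A B D E where ty: "f \<in> hom C A B" "g \<in> hom C A D" "h \<in> hom C B E" "k \<in> hom C D E"
    by (rule that) (use pushoutD(1-8)[OF p] in auto)
  note Obj = hom_Obj[OF ty(1)] hom_Obj[OF ty(4)]
  have k: "k \<in> M"
    using pushout_M[OF f p] .
  have po: "pushout C (Ident C A) g g (Ident C D)"
    using pushout_Ident[OF ty(2)] .
  have pb: "pullback C (Ident C A) (Ident C A) f f" "pullback C g (Ident C A) (Ident C D) g"
    using pullback_M_Ident[of f "Ident C A" A] pullback_M_Ident[of "Ident C D" g A] ty f Obj
    by simp_all
  have sq: "comm_square C g f k h" "comm_square C (Ident C D) (Ident C D) k k"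
    using ty Obj pushoutD(9)[OF p] by (auto simp: comm_square_def)
  have "{Ident C A, f, Ident C D, k} \<subseteq> M"
    using f k Obj by simp
  from van_Kampen_iff[OF f p this pushout_comm[OF po] sq pb]
  have "pullback C g f k h"
    using po by simp
  then show ?thesis
    by (rule pullback_sym)
qed

lemma pushout_complement_M:
  assumes "pushout C f g h k" "f \<in> M" "h \<in> M"
  shows "g \<in> M"
  using pullback_M[OF assms(3) pushout_pullback[OF assms(1,2)]] .

text \<open>Pull the pushout \<open>p\<close> back along \<open>q\<close>. The pullback of
  \<open>q \<cdot> a\<close> along \<open>q\<close> is \<open>a\<close> again, and \<open>ko\<close>
  factors through \<open>a\<close>, so the van Kampen cube has identities over \<open>K\<close> and
  \<open>Q\<close> and its top face is a pushout complement of \<open>ko\<close> and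
  \<open>a\<close>.\<close>

lemma has_poc_if_pushout:
  assumes M: "ko \<in> M" "a \<in> M" "q \<in> M" and p: "pushout C ko k (q \<cdot> a) p" and qa: "Cod C a = Dom C q"
  shows "has_poc C ko a"
proof -
  obtain K Q P L Y where ty: "ko \<in> hom C K Q" "a \<in> hom C Q P" "q \<in> hom C P Y" "k \<in> hom C K L"
    "p \<in> hom C L Y"
    by (rule that) (use pushoutD(1-8)[OF p] M qa in auto)
  note Obj = hom_Obj[OF ty(1)]
  obtain v u where pb: "pullback C v u q p"
    using pullback_along_M_ex[OF M(3), of p] ty by auto
  obtain V where ty': "v \<in> hom C V P" "u \<in> hom C V L"
    by (rule that) (use pullbackD(1-8)[OF pb] ty in auto)
  have "q \<cdot> (a \<cdot> ko) = p \<cdot> k"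
    using pushoutD(9)[OF p] ty by simp
  then obtain g where g: "g \<in> hom C K V" "v \<cdot> g = a \<cdot> ko" "u \<cdot> g = k"
    by - (rule pullback_induce[OF pb ty', of "a \<cdot> ko" K k], use ty in auto)
  have "p \<in> M"
    using pushout_M[OF M(1) p] .
  then have u: "u \<in> M"
    using pullback_M[OF M(3) pb] by blast
  have "pushout C ko g a v"
  proof (rule van_Kampen_pushout[OF p M(1) _ _ u M(3) _ _ _ pb])
    show "Ident C K \<in> M" "Ident C Q \<in> M"
      using Obj by simp_all
    show "pullback C ko (Ident C K) (Ident C Q) ko"
      using pullback_M_Ident[of "Ident C Q" ko K] ty Obj by simp
    show "pullback C g (Ident C K) u k"
      using pullback_M_Ident[of u g K] ty ty' g u by simp
    show "pullback C a (Ident C Q) q (q \<cdot> a)"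
      using pullback_M_Ident[of q a Q] ty M by simp
  qed
  then show ?thesis
    unfolding has_poc_def by blast
qed

end

section \<open>Final pullback complements: pushouts, cancellation, pasting and base change\<close>

context sqpo_category
begin

text \<open>Pulling the pushout back along its final pullback complement \<open>D \<rightarrow> J\<close> yields a pushout of an
  identity, hence the comparison \<open>L \<rightarrow> D\<close> is an isomorphism.\<close>

lemma pushout_fpc:
  assumes p: "pushout C i g a i'" and M: "i \<in> M" "a \<in> M"
  shows "fpc C i a g i'"
proof -
  obtain K I L J where ty: "i \<in> hom C K I" "g \<in> hom C K L" "a \<in> hom C I J" "i' \<in> hom C L J"
    by (rule that) (use pushoutD(1-8)[OF p] in auto)
  note Obj = hom_Obj[OF ty(1)] hom_Obj[OF ty(4)]
  have pb: "pullback C i g a i'"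
    using pushout_pullback[OF p M(1)] .
  obtain b d where f: "fpc C i a b d"
    using fpc_ex[OF M] ty by auto
  have bd: "b \<in> M" "d \<in> M"
    using fpc_M[OF M f] by simp_all
  obtain D where ty': "b \<in> hom C K D" "d \<in> hom C D J"
    by (rule that) (use fpcD(1-8)[OF f] ty in auto)
  obtain \<phi> where \<phi>: "\<phi> \<in> hom C L D" "d \<cdot> \<phi> = i'" "\<phi> \<cdot> g = b \<cdot> Ident C K"
    by (rule fpc_induce[OF f ty'(1) pb ty(2), of "Ident C K"]) (use ty Obj in auto)
  have "pushout C (Ident C K) g b \<phi>"
  proof (rule van_Kampen_pushout[OF p M(1) _ M(1) _ bd(2)])
    show "Ident C K \<in> M" "Ident C L \<in> M"
      using Obj by simp_all
    show "pullback C (Ident C K) (Ident C K) i i"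
      using pullback_M_Ident[of i "Ident C K" K] ty M Obj by simp
    show "pullback C g (Ident C K) (Ident C L) g"
      using pullback_M_Ident[of "Ident C L" g K] ty Obj by simp
    show "pullback C b i d a"
      using pullback_sym[OF fpc_pullback[OF f]] .
    show "pullback C \<phi> (Ident C L) d i'"
      using pullback_M_Ident[of d \<phi> L] ty' \<phi> bd by simp
  qed
  then have "iso C \<phi>"
    using pushout_Ident_iso ty(2) by blast
  then obtain \<psi> where \<psi>: "\<psi> \<in> hom C D L" "\<phi> \<cdot> \<psi> = Ident C D"
    using isoE \<phi>(1) by metis
  show ?thesis
  proof (rule fpcI[OF pb ty(1,2,3)])
    show "mono C i'"
      using pushout_M[OF M(1) p] M_mono by blast
    fix P Q x y z w
    assume as: "pullback C x y a z" "x \<in> hom C P I" "y \<in> hom C P Q" "z \<in> hom C Q J"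
      "w \<in> hom C P K" "i \<cdot> w = x"
    obtain u where u: "u \<in> hom C Q D" "d \<cdot> u = z"
      using fpc_induce[OF f ty'(1) as(1,3,5,6)] by blast
    have "i' \<cdot> (\<psi> \<cdot> u) = d \<cdot> (\<phi> \<cdot> (\<psi> \<cdot> u))"
      using u \<phi>(1) \<psi>(1) ty' Comp_eq[OF \<phi>(2), of "\<psi> \<cdot> u"] by simp
    also have "\<dots> = z"
      using u \<phi>(1) \<psi>(1) ty' Comp_eq[OF \<psi>(2), of u] by simp
    finally show "\<exists>u \<in> hom C Q L. i' \<cdot> u = z"
      using u \<psi>(1) by (intro bexI[of _ "\<psi> \<cdot> u"]) simp_all
  qed
qed

text \<open>Composing the first square with the monomorphism \<open>c'\<close> gives a test square
  for the second complement, whence \<open>\<beta>\<close>. That the square on \<open>d\<close> and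
  \<open>\<beta>\<close> is a pullback comes from finality of the first complement, and that it is
  final comes from finality of the second.\<close>

lemma fpc_cancel:
  assumes f: "fpc C a c b d" and f': "fpc C a (c' \<cdot> c) k l"
    and M: "a \<in> M" "c \<in> M" "c' \<in> M" and cc: "Cod C c = Dom C c'"
  obtains \<beta> where "fpc C d c' \<beta> l" "\<beta> \<cdot> b = k"
proof -
  obtain A B D E L F where ty: "a \<in> hom C A B" "c \<in> hom C B E" "b \<in> hom C A D" "d \<in> hom C D E"
    "c' \<in> hom C E F" "k \<in> hom C A L" "l \<in> hom C L F"
    by (rule that) (use fpcD(1-8)[OF f] fpcD(1-8)[OF f'] M cc in auto)
  note Obj = hom_Obj[OF ty(1)]
  have ac: "Cod C a = Dom C c"
    using ty by simp
  have M': "b \<in> M" "d \<in> M" "k \<in> M" "l \<in> M"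
    using fpc_M[OF M(1,2) f] fpc_M[OF M(1) _ f'] M_Comp[OF M(2,3) cc] by simp_all
  have "pullback C a b (c' \<cdot> c) (c' \<cdot> d)"
    using pullback_Comp_mono[OF fpc_pullback[OF f] M_mono[OF M(3)]] ty by simp
  then obtain \<beta> where \<beta>: "\<beta> \<in> hom C D L" "l \<cdot> \<beta> = c' \<cdot> d" "\<beta> \<cdot> b = k"
    by - (rule fpc_induce[OF f' ty(6) _ ty(3), of a "c' \<cdot> d" "Ident C A"], use ty Obj in auto)
  \<comment> \<open>The true pullback \<open>P\<close> of \<open>c'\<close> and \<open>l\<close> is
    compared with \<open>D\<close>: its restriction along \<open>c\<close> is again
    \<open>A\<close>, so finality of \<open>f\<close> gives \<open>v : P \<rightarrow> D\<close>
    over \<open>E\<close>. Test pairs then factor through \<open>D\<close> by way of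
    \<open>P\<close>.\<close>
  obtain s t where pst: "pullback C s t c' l"
    using pullback_along_M_ex[OF M(3), of l] ty by auto
  obtain P where tyP: "s \<in> hom C P E" "t \<in> hom C P L"
    by (rule that) (use pullbackD(1-8)[OF pst] ty in auto)
  have "c' \<cdot> (c \<cdot> a) = l \<cdot> k"
    using fpcD(9)[OF f'] ty by simp
  then obtain j where j: "j \<in> hom C A P" "s \<cdot> j = c \<cdot> a" "t \<cdot> j = k"
    by - (rule pullback_induce[OF pst tyP, of "c \<cdot> a" A k], use ty in auto)
  have "pullback C (t \<cdot> j) a l (c' \<cdot> c)"
    using pullback_sym[OF fpc_pullback[OF f']] j by simp
  moreover have "comm_square C j a s c"
    using j tyP ty by (intro comm_squareI) simp_all
  ultimately have "pullback C j a s c"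
    using pullback_sym[OF pst] by - (rule pullback_cancel)
  then have "pullback C a j c s"
    by (rule pullback_sym)
  then obtain v where v: "v \<in> hom C P D" "d \<cdot> v = s"
    by - (rule fpc_induce[OF f ty(3) _ j(1), of a s "Ident C A"], use ty Obj in auto)
  have pb: "pullback C d \<beta> c' l"
  proof (rule pullbackI[OF ty(4) \<beta>(1) ty(5,7) \<beta>(2)[symmetric]])
    fix X x y assume xy: "x \<in> hom C X E" "y \<in> hom C X L" "c' \<cdot> x = l \<cdot> y"
    obtain w where w: "w \<in> hom C X P" "s \<cdot> w = x" "t \<cdot> w = y"
      using pullback_induce[OF pst tyP xy] .
    have dv: "d \<cdot> (v \<cdot> w) = x"
      using v w tyP ty by (simp add: Comp_eq)
    have "l \<cdot> (\<beta> \<cdot> (v \<cdot> w)) = c' \<cdot> (d \<cdot> (v \<cdot> w))"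
      using Comp_eq_Comp[OF \<beta>(2), of "v \<cdot> w"] \<beta>(1) v(1) w(1) ty by simp
    then have "l \<cdot> (\<beta> \<cdot> (v \<cdot> w)) = l \<cdot> y"
      using dv xy by simp
    then have "\<beta> \<cdot> (v \<cdot> w) = y"
      using \<beta>(1) v(1) w(1) xy(2) by - (rule monoD[OF M_mono[OF M'(4)] ty(7), of _ X], simp_all)
    then show "\<exists>u \<in> hom C X D. d \<cdot> u = x \<and> \<beta> \<cdot> u = y"
      using dv v(1) w(1) by (intro bexI[of _ "v \<cdot> w"]) simp_all
  next
    fix X u v assume "u \<in> hom C X D" "v \<in> hom C X D" "d \<cdot> u = d \<cdot> v"
    then show "u = v"
      using monoD[OF M_mono[OF M'(2)] ty(4)] by blast
  qed
  have "fpc C d c' \<beta> l"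
  proof (rule fpcI[OF pb ty(4) \<beta>(1) ty(5) M_mono[OF M'(4)]])
    fix P Q x y z w
    assume as: "pullback C x y c' z" "x \<in> hom C P E" "y \<in> hom C P Q" "z \<in> hom C Q F"
      "w \<in> hom C P D" "d \<cdot> w = x"
    obtain f1 g1 where p1: "pullback C f1 g1 c x"
      using pullback_along_M_ex[OF M(2), of x] ty as by auto
    obtain S where tyS: "f1 \<in> hom C S B" "g1 \<in> hom C S P"
      by (rule that) (use pullbackD(1-8)[OF p1] ty as in auto)
    have "pullback C f1 (y \<cdot> g1) (c' \<cdot> c) z"
      using pullback_sym[OF pullback_paste[OF pullback_sym[OF p1] pullback_sym[OF as(1)]]] .
    moreover have "c \<cdot> f1 = d \<cdot> (w \<cdot> g1)"
      using pullbackD(9)[OF p1] as tyS ty Comp_eq[OF as(6), of g1] by simp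
    then obtain w1 where "w1 \<in> hom C S A" "a \<cdot> w1 = f1"
      by - (rule pullback_induce[OF fpc_pullback[OF f] ty(1,3) tyS(1), of "w \<cdot> g1"], use tyS as in auto)
    ultimately obtain u where "u \<in> hom C Q L" "l \<cdot> u = z"
      by - (rule fpc_induce[OF f' ty(6), of f1 "y \<cdot> g1" z S Q w1], use as tyS in auto)
    then show "\<exists>u \<in> hom C Q L. l \<cdot> u = z"
      by blast
  qed
  then show thesis
    using that \<beta>(3) by blast
qed

text \<open>Apply finality twice. The first application produces \<open>u\<close>, and cancelling
  the pullback of \<open>f\<close> from the test square leaves a test square over \<open>b\<close>
  and \<open>u\<close>, to which \<open>f'\<close> applies.\<close>

lemma fpc_paste:
  assumes f: "fpc C a c b d" and f': "fpc C a' b b' d'" and M: "d \<in> M" "d' \<in> M"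
  shows "fpc C (a \<cdot> a') c b' (d \<cdot> d')"
proof -
  obtain A B D E A' D' where ty: "a \<in> hom C A B" "c \<in> hom C B E" "b \<in> hom C A D" "d \<in> hom C D E"
    "a' \<in> hom C A' A" "b' \<in> hom C A' D'" "d' \<in> hom C D' D"
    by (rule that) (use fpcD(1-8)[OF f] fpcD(1-8)[OF f'] in auto)
  show ?thesis
  proof (rule fpcI)
    show "pullback C (a \<cdot> a') b' c (d \<cdot> d')"
      using pullback_paste[OF fpc_pullback[OF f'] fpc_pullback[OF f]] .
    show "a \<cdot> a' \<in> hom C A' B" "b' \<in> hom C A' D'" "c \<in> hom C B E"
      using ty by simp_all
    have "d \<cdot> d' \<in> M"
      using M_Comp[OF M(2,1)] ty by simp
    then show "mono C (d \<cdot> d')"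
      by (rule M_mono)
    fix P Q x y z w
    assume as: "pullback C x y c z" "x \<in> hom C P B" "y \<in> hom C P Q" "z \<in> hom C Q E"
      "w \<in> hom C P A'" "(a \<cdot> a') \<cdot> w = x"
    obtain u where u: "u \<in> hom C Q D" "d \<cdot> u = z" "u \<cdot> y = b \<cdot> (a' \<cdot> w)"
      by (rule fpc_induce[OF f ty(3) as(1,3), of "a' \<cdot> w"]) (use as ty in auto)
    have "pullback C (a \<cdot> (a' \<cdot> w)) y c (d \<cdot> u)"
      using as(1,5,6) u ty by simp
    moreover have "comm_square C (a' \<cdot> w) y b u"
      using as(3,5) u ty by (intro comm_squareI) simp_all
    ultimately have "pullback C (a' \<cdot> w) y b u"
      using fpc_pullback[OF f] by - (rule pullback_cancel)
    then obtain u' where "u' \<in> hom C Q D'" "d' \<cdot> u' = u"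
      using fpc_induce[OF f' ty(6) _ as(3,5)] by blast
    then show "\<exists>u \<in> hom C Q D'. (d \<cdot> d') \<cdot> u = z"
      using u ty by (intro bexI[of _ u']) simp_all
  qed
qed

text \<open>Final pullback complements are stable under pullback along \<open>p\<close>: pasting
  with \<open>vk\<close> turns a test square over \<open>k\<close> into one over \<open>h\<close>,
  and the morphism into \<open>L\<close> obtained from finality lifts to the pullback
  \<open>U\<close> of \<open>l\<close> and \<open>p\<close>.\<close>

lemma fpc_base_change:
  assumes f: "fpc C b h \<beta> l" and vk: "pullback C v k h p" and ea: "pullback C e a b v"
    and xy: "pullback C x y l p" and l: "l \<in> M"
  obtains \<delta> where "fpc C a k \<delta> y" "pullback C \<delta> a y k" "x \<cdot> \<delta> = \<beta> \<cdot> e"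
proof -
  obtain K N L X V L' W U where ty: "b \<in> hom C K N" "h \<in> hom C N X" "\<beta> \<in> hom C K L" "l \<in> hom C L X"
    "v \<in> hom C V N" "k \<in> hom C V L'" "p \<in> hom C L' X" "e \<in> hom C W K" "a \<in> hom C W V"
    "x \<in> hom C U L" "y \<in> hom C U L'"
    by (rule that) (use fpcD(1-8)[OF f] pullbackD(1-8)[OF vk] pullbackD(1-8)[OF ea]
        pullbackD(1-8)[OF xy] in auto)
  note eq = fpcD(9)[OF f] pullbackD(9)[OF vk] pullbackD(9)[OF ea] pullbackD(9)[OF xy]
  have y: "y \<in> M"
    using pullback_M[OF l xy] .
  have "l \<cdot> (\<beta> \<cdot> e) = h \<cdot> (b \<cdot> e)"
    using Comp_eq_Comp[OF eq(1), of e] ty by simp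
  also have "\<dots> = p \<cdot> (k \<cdot> a)"
    using Comp_eq_Comp[OF eq(2), of a] ty eq(3) by simp
  finally obtain \<delta> where \<delta>: "\<delta> \<in> hom C W U" "x \<cdot> \<delta> = \<beta> \<cdot> e" "y \<cdot> \<delta> = k \<cdot> a"
    by - (rule pullback_induce[OF xy ty(10,11), of "\<beta> \<cdot> e" W "k \<cdot> a"], use ty in auto)
  have "pullback C (x \<cdot> \<delta>) a l (p \<cdot> k)"
    using pullback_paste[OF ea pullback_sym[OF fpc_pullback[OF f]]] \<delta> eq(2) by simp
  moreover have "comm_square C \<delta> a y k"
    using \<delta> ty by (intro comm_squareI) simp_all
  ultimately have pb: "pullback C \<delta> a y k"
    using xy by - (rule pullback_cancel)
  have "fpc C a k \<delta> y"
  proof (rule fpcI[OF pullback_sym[OF pb] ty(9) \<delta>(1) ty(6) M_mono[OF y]])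
    fix P Q x' y' z w
    assume as: "pullback C x' y' k z" "x' \<in> hom C P V" "y' \<in> hom C P Q" "z \<in> hom C Q L'"
      "w \<in> hom C P W" "a \<cdot> w = x'"
    have "pullback C (v \<cdot> x') y' h (p \<cdot> z)"
      using pullback_paste[OF as(1) vk] .
    moreover have "b \<cdot> (e \<cdot> w) = v \<cdot> x'"
      using Comp_eq_Comp[OF eq(3), of w] as ty by simp
    ultimately obtain u where u: "u \<in> hom C Q L" "l \<cdot> u = p \<cdot> z"
      by - (rule fpc_induce[OF f ty(3) _ as(3), of "v \<cdot> x'" "p \<cdot> z" "e \<cdot> w"], use ty as in auto)
    obtain u' where "u' \<in> hom C Q U" "y \<cdot> u' = z"
      using pullback_induce[OF xy ty(10,11) u(1) as(4) u(2)] by blast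
    then show "\<exists>u \<in> hom C Q U. y \<cdot> u = z"
      by blast
  qed
  then show thesis
    using that pb \<delta>(2) by blast
qed

end

section \<open>Extending a derivation along its match and its comatch\<close>

context sqpo_category
begin

text \<open>Cancelling the pushout \<open>po\<close> from the comatch square gives \<open>u\<close>,
  by which the pushout property of \<open>pi\<close> assembles \<open>n'\<close> from
  \<open>n\<close> and \<open>l \<cdot> u\<close>. Cancelling \<open>pi\<close> from the derivation
  then gives the complement of \<open>ki'\<close> and \<open>n'\<close>.\<close>

lemma extend_match_forward:
  assumes M: "ko \<in> M" "ki \<in> M" "n \<in> M" "a \<in> M" "q \<in> M" and qa: "Cod C a = Dom C q"
    and f: "fpc C ki n k l" and p: "pushout C ko k (q \<cdot> a) p"
    and po: "pushout C ko g a ko'" and pi: "pushout C ki g a' ki'"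
  obtains u n' where "fpc C ki' n' u l" "pushout C ko' u q p" "u \<cdot> g = k" "n' \<cdot> a' = n" "n' \<in> M"
proof -
  obtain K I L X where ty1: "ki \<in> hom C K I" "n \<in> hom C I X" "k \<in> hom C K L" "l \<in> hom C L X"
    by (rule that) (use fpcD(1-8)[OF f] in auto)
  obtain Q Q' Y where ty2: "a \<in> hom C Q Q'" "q \<in> hom C Q' Y"
    by (rule that) (use M qa in auto)
  have ty3: "ko \<in> hom C K Q" "p \<in> hom C L Y"
    using pushoutD(1-8)[OF p] ty1 ty2 by simp_all
  obtain K' where ty4: "g \<in> hom C K K'" "ko' \<in> hom C K' Q'"
    by (rule that) (use pushoutD(1-8)[OF po] ty2 ty3 in auto)
  obtain I' where ty5: "a' \<in> hom C I I'" "ki' \<in> hom C K' I'"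
    by (rule that) (use pushoutD(1-8)[OF pi] ty1 ty4 in auto)
  note ty = ty3(1) ty1 ty2(2,1) ty3(2) ty4 ty5
  have kl: "k \<in> M" "l \<in> M"
    using fpc_M[OF M(2,3) f] ty by simp_all
  have g: "g \<in> M"
    using pushout_complement_M[OF po M(1,4)] .
  have a': "a' \<in> M"
    using pushout_M'[OF g pi] .
  have qaM: "q \<cdot> a \<in> M"
    using M_Comp[OF M(4,5) qa] .
  obtain u where u: "fpc C ko' q u p" "u \<cdot> g = k"
    using fpc_cancel[OF pushout_fpc[OF po M(1,4)] pushout_fpc[OF p M(1) qaM] M(1,4,5) qa] by blast
  have tyu: "u \<in> hom C K' L"
    using fpcD(1-8)[OF u(1)] ty by simp
  have uM: "u \<in> M"
    using fpc_M[OF pushout_M[OF M(1) po] M(5) u(1)] ty by simp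
  have "pushout C (u \<cdot> g) ko p (q \<cdot> a)"
    using pushout_sym[OF p] u(2) by simp
  then have "pushout C u ko' p q"
    using pushout_sym[OF po] iffD1[OF comm_square_sym pullback_comm[OF fpc_pullback[OF u(1)]]]
    by - (rule pushout_cancel)
  then have pou: "pushout C ko' u q p"
    by (rule pushout_sym)
  have "n \<cdot> ki = (l \<cdot> u) \<cdot> g"
    using fpcD(9)[OF f] u(2) tyu ty by simp
  then obtain n' where n': "n' \<in> hom C I' X" "n' \<cdot> a' = n" "n' \<cdot> ki' = l \<cdot> u"
    by - (rule pushout_induce[OF pi ty(11,12,3), of "l \<cdot> u"], use ty tyu in auto)
  \<comment> \<open>Effective unions apply to \<open>n'\<close> once \<open>n\<close> and
    \<open>l \<cdot> u\<close> are known to intersect exactly in \<open>K\<close>.\<close>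
  have "pullback C ki g n (l \<cdot> u)"
    using pullback_precomp_mono[of ki u g n l] fpc_pullback[OF f] u(2) M_mono[OF uM] tyu ty by simp
  moreover have "l \<cdot> u \<in> M"
    using M_Comp[OF uM kl(2)] tyu ty by simp
  ultimately have n'M: "n' \<in> M"
    using M_effective_unions[OF M(2) g pi M(3), of "l \<cdot> u" n'] n' ty by simp
  have "fpc C ki (n' \<cdot> a') k l"
    using f n' by simp
  then obtain u' where u': "fpc C ki' n' u' l" "u' \<cdot> g = k"
    using fpc_cancel[OF pushout_fpc[OF pi M(2) a'] _ M(2) a' n'M] n' ty by auto
  \<comment> \<open>The two cancellations produce \<open>u\<close> and \<open>u'\<close> separately;
    both composites with the monomorphism \<open>l\<close> equal \<open>n' \<cdot> ki'\<close>, so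
    they agree.\<close>
  have "l \<cdot> u' = l \<cdot> u"
    using fpcD(9)[OF u'(1)] n' by simp
  moreover have "u' \<in> hom C K' L"
    using fpcD(1-8)[OF u'(1)] ty by simp
  ultimately have "u' = u"
    using tyu by - (rule monoD[OF M_mono[OF kl(2)] ty(5)])
  then show thesis
    using that[of n' u] u' pou n' n'M by simp
qed

text \<open>Here cancellation starts on the match side. In contrast to the converse direction,
  \<open>q \<in> M\<close> follows from stability of \<open>M\<close> under pushout, as
  \<open>q\<close> is opposite to \<open>u\<close> in a pushout.\<close>

lemma extend_match_backward:
  assumes M: "ko \<in> M" "ki \<in> M" "n' \<in> M" "a \<in> M" and na: "Cod C a' = Dom C n'"
    and f: "fpc C ki (n' \<cdot> a') k l" and p: "pushout C ko k h p"
    and po: "pushout C ko g a ko'" and pi: "pushout C ki g a' ki'"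
  obtains u q where "fpc C ki' n' u l" "pushout C ko' u q p" "u \<cdot> g = k" "q \<cdot> a = h" "q \<in> M"
proof -
  obtain I I' X where ty1: "a' \<in> hom C I I'" "n' \<in> hom C I' X"
    by (rule that) (use M na pushoutD(3)[OF pi] in auto)
  obtain K L where ty2: "ki \<in> hom C K I" "k \<in> hom C K L" "l \<in> hom C L X"
    by (rule that) (use fpcD(1-8)[OF f] ty1 in auto)
  obtain Q Y where ty3: "ko \<in> hom C K Q" "h \<in> hom C Q Y" "p \<in> hom C L Y"
    by (rule that) (use pushoutD(1-8)[OF p] ty2 in auto)
  obtain K' Q' where ty4: "g \<in> hom C K K'" "a \<in> hom C Q Q'" "ko' \<in> hom C K' Q'"
    by (rule that) (use pushoutD(1-8)[OF po] ty3 in auto)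
  have ty5: "ki' \<in> hom C K' I'"
    using pushoutD(1-8)[OF pi] ty1 ty4 by simp
  note ty = ty3(1) ty2(1) ty1(2) ty2(2,3) ty3(2) ty4(2) ty3(3) ty4(1,3) ty1(1) ty5
  have g: "g \<in> M"
    using pushout_complement_M[OF po M(1,4)] .
  have a': "a' \<in> M"
    using pushout_M'[OF g pi] .
  obtain u where u: "fpc C ki' n' u l" "u \<cdot> g = k"
    using fpc_cancel[OF pushout_fpc[OF pi M(2) a'] f M(2) a' M(3) na] by blast
  have tyu: "u \<in> hom C K' L"
    using fpcD(1-8)[OF u(1)] ty by simp
  have uM: "u \<in> M"
    using fpc_M[OF pushout_M[OF M(2) pi] M(3) u(1)] ty by simp
  have "h \<cdot> ko = (p \<cdot> u) \<cdot> g"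
    using pushoutD(9)[OF p] u(2) tyu ty by simp
  then obtain q where q: "q \<in> hom C Q' Y" "q \<cdot> a = h" "q \<cdot> ko' = p \<cdot> u"
    by - (rule pushout_induce[OF po ty(7,10,6), of "p \<cdot> u"], use ty tyu in auto)
  have "pushout C (u \<cdot> g) ko p (q \<cdot> a)"
    using pushout_sym[OF p] u(2) q(2) by simp
  moreover have "comm_square C u ko' p q"
    using q tyu ty by (intro comm_squareI[of u K' L ko' Q' p Y q]) simp_all
  ultimately have pou: "pushout C u ko' p q"
    using pushout_sym[OF po] by - (rule pushout_cancel)
  have "q \<in> M"
    using pushout_M[OF uM pou] .
  then show thesis
    using that[of u q] u pushout_sym[OF pou] q by simp
qed

section \<open>Correctness of Shift and Trans\<close>

lemma the_pushout_pushout: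
  assumes "f \<in> M" "g \<in> Arr C" "Dom C f = Dom C g"
  shows "pushout C f g (fst (the_pushout C f g)) (snd (the_pushout C f g))"
proof -
  have "\<exists>hk. case hk of (h, k) \<Rightarrow> pushout C f g h k"
    using pushout_along_M_ex[OF assms] by auto
  then show ?thesis
    unfolding the_pushout_def by (rule someI2_ex) (simp add: case_prod_beta)
qed

lemma the_pullback_pullback:
  assumes "h \<in> M" "k \<in> Arr C" "Cod C h = Cod C k"
  shows "pullback C (fst (the_pullback C h k)) (snd (the_pullback C h k)) h k"
proof -
  have "\<exists>fg. case fg of (f, g) \<Rightarrow> pullback C f g h k"
    using pullback_along_M_ex[OF assms] by auto
  then show ?thesis
    unfolding the_pullback_def by (rule someI2_ex) (simp add: case_prod_beta)
qed

lemma the_fpc_fpc: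
  assumes "a \<in> M" "c \<in> M" "Cod C a = Dom C c"
  shows "fpc C a c (fst (the_fpc C a c)) (snd (the_fpc C a c))"
proof -
  have "\<exists>bd. case bd of (b, d) \<Rightarrow> fpc C a c b d"
    using fpc_ex[OF assms] by auto
  then show ?thesis
    unfolding the_fpc_def by (rule someI2_ex) (simp add: case_prod_beta)
qed

lemma the_poc_pushout:
  assumes "has_poc C f h"
  shows "pushout C f (fst (the_poc C f h)) h (snd (the_poc C f h))"
proof -
  have "\<exists>gk. case gk of (g, k) \<Rightarrow> pushout C f g h k"
    using assms by (auto simp: has_poc_def)
  then show ?thesis
    unfolding the_poc_def by (rule someI2_ex) (simp add: case_prod_beta)
qed

section \<open>The cospans of \<open>Shift\<close> and their representatives\<close>

lemma shift_cospansI: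
  assumes "pushout C p'' a'' r s" "p'' \<in> M" "p'' \<in> hom C X (Cod C p)" "a'' \<in> M"
    "a'' \<in> hom C X (Cod C a)" "x \<in> M" "x \<in> hom C (Dom C p) X" "p'' \<cdot> x = p" "a'' \<cdot> x = a"
  shows "(r, s) \<in> shift_cospans C M p a"
  unfolding shift_cospans_def using assms by blast

lemma shift_cospansD:
  assumes "(r, s) \<in> shift_cospans C M p a" "p \<in> M"
  shows "r \<in> M" "s \<in> M" "Dom C r = Cod C p" "Dom C s = Cod C a" "Cod C r = Cod C s" "r \<cdot> p = s \<cdot> a"
proof -
  obtain X p'' a'' x where *: "p'' \<in> M \<inter> hom C X (Cod C p)" "a'' \<in> M \<inter> hom C X (Cod C a)"
    "x \<in> M \<inter> hom C (Dom C p) X" "p'' \<cdot> x = p" "a'' \<cdot> x = a" "pushout C p'' a'' r s"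
    using assms(1) unfolding shift_cospans_def by blast
  show rs: "r \<in> M" "s \<in> M"
    using pushout_M'[OF _ *(6)] pushout_M[OF _ *(6)] * by simp_all
  show ty: "Dom C r = Cod C p" "Dom C s = Cod C a" "Cod C r = Cod C s"
    using pushoutD(1-8)[OF *(6)] *(1,2) by simp_all
  have "r \<cdot> (p'' \<cdot> x) = s \<cdot> (a'' \<cdot> x)"
    using *(1-3) rs ty by (intro Comp_eq_Comp[OF pushoutD(9)[OF *(6)]]) simp_all
  then show "r \<cdot> p = s \<cdot> a"
    using * by simp
qed

lemma cospan_iso_refl:
  assumes "rs \<in> shift_cospans C M p a"
  shows "cospan_iso C rs rs"
proof -
  obtain p'' a'' where "pushout C p'' a'' (fst rs) (snd rs)"
    using assms unfolding shift_cospans_def by fastforce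
  then show ?thesis
    unfolding cospan_iso_def using pushoutD(1-8)[of C p'' a'' "fst rs" "snd rs"]
    by (intro bexI[of _ "Ident C (Cod C (fst rs))"]) (auto simp: iso_Ident)
qed

text \<open>Reflexivity of \<open>cospan_iso\<close> makes every class nonempty, so that the chosen
  representative really belongs to its class.\<close>

lemma shift_reps_subset: "shift_reps C M p a \<subseteq> shift_cospans C M p a"
proof
  fix t assume "t \<in> shift_reps C M p a"
  then obtain K where K: "t = (SOME rs. rs \<in> K)" "K \<in> shift_cospans C M p a //
      {(rs, rs'). rs \<in> shift_cospans C M p a \<and> rs' \<in> shift_cospans C M p a \<and> cospan_iso C rs rs'}"
    unfolding shift_reps_def by blast
  from K(2) obtain rs where rs: "rs \<in> shift_cospans C M p a"
    "K = {rs' \<in> shift_cospans C M p a. cospan_iso C rs rs'}"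
    by (auto elim!: quotientE)
  then have "rs \<in> K"
    using cospan_iso_refl by simp
  then have "t \<in> K"
    unfolding K(1) by (rule someI)
  then show "t \<in> shift_cospans C M p a"
    using rs by simp
qed

lemma shift_reps_ex:
  assumes "rs \<in> shift_cospans C M p a"
  shows "\<exists>t \<in> shift_reps C M p a. cospan_iso C rs t"
proof -
  define R where "R = {(rs, rs'). rs \<in> shift_cospans C M p a \<and> rs' \<in> shift_cospans C M p a \<and>
    cospan_iso C rs rs'}"
  define t where "t = (SOME t. t \<in> R `` {rs})"
  have "t \<in> shift_reps C M p a"
    unfolding shift_reps_def R_def[symmetric] t_def using assms by (intro imageI quotientI)
  moreover have "rs \<in> R `` {rs}"
    using assms cospan_iso_refl by (simp add: R_def)
  then have "t \<in> R `` {rs}"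
    unfolding t_def by (rule someI)
  then have "cospan_iso C rs t"
    by (simp add: R_def)
  ultimately show ?thesis
    by blast
qed

lemma sat_CExI:
  assumes "t \<in> M" "t \<in> hom C (Cod C a) (Cod C p)" "p = t \<cdot> a" "sat C M c t"
  shows "sat C M (CEx a c) p"
  unfolding sat.simps using assms by blast

lemma sat_CDisj: "sat C M (CDisj J F) p \<longleftrightarrow> (\<exists>j \<in> J. sat C M (F j) p)"
  by (simp add: CDisj_def)

lemma sat_CAnd: "sat C M (CAnd c d) p \<longleftrightarrow> sat C M c p \<and> sat C M d p"
  by (simp add: CAnd_def)

lemma sat_CFalse: "\<not> sat C M CFalse p"
  by (simp add: CFalse_def)

lemma cond_over_Shift:
  assumes "cond_over C M c (Dom C p)" "p \<in> M"
  shows "cond_over C M (Shift C M c p) (Cod C p)"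
  using assms
proof (induction c arbitrary: p)
  case (CEx a c)
  have "cond_over C M (CEx r (Shift C M c s)) (Cod C p)" if "(r, s) \<in> shift_reps C M p a" for r s
    using shift_cospansD[OF subsetD[OF shift_reps_subset that] CEx.prems(2)]
      CEx.IH[of s] CEx.prems by simp
  then show ?case
    using CEx.prems by (auto simp: CDisj_def)
qed auto

text \<open>In the existential case a factorization \<open>q = e \<cdot> r\<close> gives
  \<open>q \<cdot> p = (e \<cdot> s) \<cdot> a\<close>. Conversely, if
  \<open>q \<cdot> p = t \<cdot> a\<close>, then \<open>q\<close> and \<open>t\<close> are jointly
  covered by the pushout over their intersection, and by effective unions this pushout embeds into
  their common codomain.\<close>

lemma sat_Shift:
  assumes "cond_over C M c (Dom C p)" "p \<in> M" "q \<in> M" "Dom C q = Cod C p"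
  shows "sat C M (Shift C M c p) q \<longleftrightarrow> sat C M c (q \<cdot> p)"
  using assms
proof (induction c arbitrary: p q)
  case (CEx a c)
  have a: "a \<in> M" "Dom C a = Dom C p" and c: "cond_over C M c (Cod C a)"
    using CEx.prems(1) by simp_all
  have p: "p \<in> M" and q: "q \<in> M" "Dom C q = Cod C p"
    using CEx.prems by simp_all
  have "sat C M (Shift C M (CEx a c) p) q \<longleftrightarrow>
      (\<exists>(r, s) \<in> shift_reps C M p a. sat C M (CEx r (Shift C M c s)) q)"
    by (simp add: sat_CDisj case_prod_beta)
  also have "\<dots> \<longleftrightarrow> sat C M (CEx a c) (q \<cdot> p)"
  proof
    assume "\<exists>(r, s) \<in> shift_reps C M p a. sat C M (CEx r (Shift C M c s)) q"
    then obtain r s e where rs: "(r, s) \<in> shift_reps C M p a" and e: "e \<in> M"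
      "e \<in> hom C (Cod C r) (Cod C q)" "q = e \<cdot> r" "sat C M (Shift C M c s) e"
      by auto
    note d = shift_cospansD[OF subsetD[OF shift_reps_subset rs] p]
    have "e \<cdot> s \<in> M"
      using M_Comp[OF d(2) e(1)] d e(2) by simp
    moreover have "q \<cdot> p = (e \<cdot> s) \<cdot> a"
      using d e a p by simp
    moreover have "sat C M c (e \<cdot> s)"
      using CEx.IH[of s e] d e c by simp
    ultimately show "sat C M (CEx a c) (q \<cdot> p)"
      by - (rule sat_CExI[of "e \<cdot> s"], use d e(1,2) p q a in simp_all)
  next
    assume "sat C M (CEx a c) (q \<cdot> p)"
    then obtain t where t: "t \<in> M" "Dom C t = Cod C a" "Cod C t = Cod C q" "q \<cdot> p = t \<cdot> a"
      "sat C M c t"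
      using p q by auto
    \<comment> \<open>The intersection of \<open>q\<close> and \<open>t\<close> is the span whose
      pushout is the required cospan; \<open>p\<close> and \<open>a\<close> factor through it
      because \<open>q \<cdot> p = t \<cdot> a\<close>.\<close>
    obtain p'' a'' where pb: "pullback C p'' a'' q t"
      using pullback_along_M_ex[OF q(1), of t] t by auto
    obtain P Q A Y where ty1: "p \<in> hom C P Q" "a \<in> hom C P A" "q \<in> hom C Q Y" "t \<in> hom C A Y"
      by (rule that) (use p a q t(1-3) in auto)
    obtain X where ty2: "p'' \<in> hom C X Q" "a'' \<in> hom C X A"
      by (rule that) (use pullbackD(1-8)[OF pb] ty1 in auto)
    note ty = ty1 ty2
    have M: "p'' \<in> M" "a'' \<in> M"
      using pullback_M[OF q(1) pb] pullback_M'[OF t(1) pb] by simp_all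
    obtain x where x: "x \<in> hom C P X" "p'' \<cdot> x = p" "a'' \<cdot> x = a"
      using pullback_induce[OF pb ty(5,6,1,2) t(4)] .
    have "x \<in> M"
      using M_decomp[of x p''] x M p ty by simp
    obtain r s where po: "pushout C p'' a'' r s"
      using pushout_along_M_ex[OF M(1), of a''] ty by auto
    have "(r, s) \<in> shift_cospans C M p a"
      by (rule shift_cospansI[OF po]) (use x M \<open>x \<in> M\<close> ty in simp_all)
    then obtain r' s' where r's': "(r', s') \<in> shift_reps C M p a" "cospan_iso C (r, s) (r', s')"
      using shift_reps_ex by (metis surj_pair)
    note d = shift_cospansD[OF subsetD[OF shift_reps_subset r's'(1)] p]
    obtain E where tyE: "r \<in> hom C Q E" "s \<in> hom C A E"
      by (rule that) (use pushoutD(1-8)[OF po] ty in auto)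
    have "Cod C r = E"
      using tyE by simp
    then obtain \<phi> where \<phi>: "\<phi> \<in> hom C E (Cod C r')" "iso C \<phi>" "\<phi> \<cdot> r = r'" "\<phi> \<cdot> s = s'"
      using r's'(2) unfolding cospan_iso_def fst_conv snd_conv by blast
    obtain \<psi> where \<psi>: "\<psi> \<in> hom C (Cod C r') E" "iso C \<psi>" "\<psi> \<cdot> \<phi> = Ident C E"
      using isoE[OF \<phi>(2,1)] by metis
    obtain e where e: "e \<in> hom C E Y" "e \<cdot> r = q" "e \<cdot> s = t"
      using pushout_induce[OF po tyE ty(3,4) pullbackD(9)[OF pb]] .
    have "e \<in> M"
      using M_effective_unions[OF M po q(1) t(1) pb _ e(2,3)] e tyE ty by simp
    have E: "E \<in> Obj C"
      using hom_Obj[OF tyE(1)] by simp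
    \<comment> \<open>The disjunction contains only the representative \<open>(r', s')\<close>, so
      the embedding \<open>e\<close> is transported along the inverse \<open>\<psi>\<close> of the
      isomorphism of cospans.\<close>
    have e': "e \<cdot> \<psi> \<in> M"
      using M_Comp[OF iso_in_M[OF \<psi>(2)] \<open>e \<in> M\<close>] \<psi> e by simp
    have eq: "(e \<cdot> \<psi>) \<cdot> (\<phi> \<cdot> r) = q" "(e \<cdot> \<psi>) \<cdot> (\<phi> \<cdot> s) = t"
      using e \<phi>(1) \<psi>(1) tyE E by (simp_all add: Comp_eq[OF \<psi>(3)])
    then have "sat C M (Shift C M c s') (e \<cdot> \<psi>)"
      using CEx.IH[of s' "e \<cdot> \<psi>"] d c e' t(5) \<phi> \<psi>(1) e(1) ty by simp
    then have "sat C M (CEx r' (Shift C M c s')) q"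
      by - (rule sat_CExI[OF e'], use eq(1) \<phi>(1,3) \<psi>(1) e(1) ty in simp_all)
    then show "\<exists>(r, s) \<in> shift_reps C M p a. sat C M (CEx r (Shift C M c s)) q"
      using r's'(1) by blast
  qed
  finally show ?case .
qed auto

text \<open>The rule and its derivation vary in the induction, since an existential passes to the
  extended rule, while \<open>l\<close> stays the same. If the pushout complement exists, the two
  extension lemmas match factorizations of \<open>n\<close> with those of \<open>h\<close>; if not,
  \<open>h\<close> has no factorization through \<open>a\<close>, by
  \<open>has_poc_if_pushout\<close>.\<close>

lemma sat_Trans:
  assumes "cond_over C M c (Cod C ko)" "ko \<in> M" "ki \<in> M" "n \<in> M" "h \<in> M"
    "fpc C ki n k l" "pushout C ko k h p"
  shows "sat C M (Trans C c ko ki) n \<longleftrightarrow> sat C M c h"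
  using assms
proof (induction c arbitrary: ko ki n h k p)
  case (CEx a c)
  note M = CEx.prems(2-5)
  have a: "a \<in> M" "Dom C a = Cod C ko" and c: "cond_over C M c (Cod C a)"
    using CEx.prems(1) by simp_all
  obtain K Q I L X Y A where ty: "ko \<in> hom C K Q" "ki \<in> hom C K I" "n \<in> hom C I X"
    "k \<in> hom C K L" "l \<in> hom C L X" "h \<in> hom C Q Y" "p \<in> hom C L Y" "a \<in> hom C Q A"
    by (rule that) (use fpcD(1-8)[OF CEx.prems(6)] pushoutD(1-8)[OF CEx.prems(7)] a in auto)
  show ?case
  proof (cases "has_poc C ko a")
    case False
    have "\<not> sat C M (CEx a c) h"
    proof
      assume "sat C M (CEx a c) h"
      then obtain q where "q \<in> M" "q \<in> hom C A Y" "h = q \<cdot> a"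
        using ty by auto
      then have "has_poc C ko a"
        using has_poc_if_pushout[OF M(1) a(1), of q k p] CEx.prems(7) ty by simp
      with False show False ..
    qed
    then show ?thesis
      using False by (simp add: sat_CFalse)
  next
    case True
    define g ko' where "g = fst (the_poc C ko a)" and "ko' = snd (the_poc C ko a)"
    have po: "pushout C ko g a ko'"
      unfolding g_def ko'_def using the_poc_pushout[OF True] .
    obtain K' where tyK: "g \<in> hom C K K'" "ko' \<in> hom C K' A"
      by (rule that) (use pushoutD(1-8)[OF po] ty in auto)
    define a' ki' where "a' = fst (the_pushout C ki g)" and "ki' = snd (the_pushout C ki g)"
    have pi: "pushout C ki g a' ki'"
      unfolding a'_def ki'_def using the_pushout_pushout[OF M(2), of g] tyK ty by simp
    obtain I' where tyI: "a' \<in> hom C I I'" "ki' \<in> hom C K' I'"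
      by (rule that) (use pushoutD(1-8)[OF pi] ty tyK in auto)
    have M': "ko' \<in> M" "ki' \<in> M"
      using pushout_M[OF M(1) po] pushout_M[OF M(2) pi] by simp_all
    have "sat C M (Trans C (CEx a c) ko ki) n \<longleftrightarrow> sat C M (CEx a' (Trans C c ko' ki')) n"
      using True by (simp add: g_def ko'_def a'_def ki'_def case_prod_beta)
    also have "\<dots> \<longleftrightarrow> sat C M (CEx a c) h"
    proof
      assume "sat C M (CEx a' (Trans C c ko' ki')) n"
      then obtain n' where n': "n' \<in> M" "n' \<in> hom C I' X" "n = n' \<cdot> a'" "sat C M (Trans C c ko' ki') n'"
        using ty tyI by auto
      have "fpc C ki (n' \<cdot> a') k l" "Cod C a' = Dom C n'"
        using CEx.prems(6) n' tyI by simp_all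
      from extend_match_backward[OF M(1,2) n'(1) a(1) this(2,1) CEx.prems(7) po pi]
      obtain u q where uq: "fpc C ki' n' u l" "pushout C ko' u q p" "q \<cdot> a = h" "q \<in> M"
        by blast
      have "sat C M c q"
        using CEx.IH[OF _ M' n'(1) uq(4,1,2)] n'(4) c tyK ty by simp
      moreover have "q \<in> hom C A Y"
        using pushoutD(1-8)[OF uq(2)] tyK ty by simp
      ultimately show "sat C M (CEx a c) h"
        using uq ty by - (rule sat_CExI[of q], simp_all)
    next
      assume "sat C M (CEx a c) h"
      then obtain q where q: "q \<in> M" "q \<in> hom C A Y" "h = q \<cdot> a" "sat C M c q"
        using ty by auto
      have "pushout C ko k (q \<cdot> a) p" "Cod C a = Dom C q"
        using CEx.prems(7) q ty by simp_all
      from extend_match_forward[OF M(1-3) a(1) q(1) this(2) CEx.prems(6) this(1) po pi]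
      obtain u n' where un: "fpc C ki' n' u l" "pushout C ko' u q p" "n' \<cdot> a' = n" "n' \<in> M"
        by blast
      have "sat C M (Trans C c ko' ki') n'"
        using CEx.IH[OF _ M' un(4) q(1) un(1,2)] q(4) c tyK ty by simp
      moreover have "n' \<in> hom C I' X"
        using fpcD(1-8)[OF un(1)] tyI ty by simp
      ultimately show "sat C M (CEx a' (Trans C c ko' ki')) n"
        using un ty tyI by - (rule sat_CExI[of n'], simp_all)
    qed
    finally show ?thesis .
  qed
qed auto

section \<open>Derivations of the composite\<close>

text \<open>Since \<open>rewrite\<close> is defined by choice, a derivation built by hand can only
  be compared with it up to isomorphism.\<close>

lemma rewrite_isomorphic:
  assumes M: "inm R \<in> M" "outm R \<in> M" "m \<in> M"
    and f: "fpc C (inm R) m k l" and p: "pushout C (outm R) k c q"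
  shows "isomorphic C (rewrite C R m) (Cod C c)"
proof -
  have im: "Cod C (inm R) = Dom C m"
    using fpcD(6)[OF f] by simp
  define k' l' where "k' = fst (sqpo_fpc C R m)" and "l' = snd (sqpo_fpc C R m)"
  have f': "fpc C (inm R) m k' l'"
    unfolding k'_def l'_def sqpo_fpc_def using the_fpc_fpc[OF M(1,3) im] .
  obtain \<phi> where \<phi>: "\<phi> \<in> hom C (Cod C k) (Cod C k')" "iso C \<phi>" "\<phi> \<cdot> k = k'"
    using fpc_isomorphic[OF f _ f'] M_mono fpc_M[OF M(1,3) f] fpc_M[OF M(1,3) f'] by metis
  have "pushout C (outm R) k' (fst (sqpo_pushout C R m)) (snd (sqpo_pushout C R m))"
    unfolding sqpo_pushout_def k'_def[symmetric]
    using the_pushout_pushout[OF M(2), of k'] fpcD(1-5)[OF f] fpcD(1-5)[OF f'] pushoutD(5)[OF p]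
    by simp
  then show ?thesis
    using pushout_iso_complement[OF p \<phi>(2)] \<phi> unfolding rewrite_def by simp
qed

text \<open>The second derivation is first cut down to the complement \<open>\<beta>\<close> of
  \<open>b\<close> and \<open>h\<close>. Pulled back along \<open>p1\<close> and pasted onto the
  first derivation, it gives the complement for the composite; the van Kampen property of
  \<open>pu\<close> and one more pasting give the pushout.\<close>

lemma composite_derivation:
  assumes M: "i2 \<in> M" "m2' \<in> M" "h \<in> M" "n \<in> M" "v \<in> M" "j \<in> M" and mh: "Cod C m2' = Dom C h"
    and fb: "fpc C i2 m2' \<kappa> b" and po2: "pushout C o2 \<kappa> s2 t2" and pb: "pullback C e a b v"
    and fn: "fpc C j n u l1" and pu: "pushout C v u h p1"
    and f2: "fpc C i2 (h \<cdot> m2') k2 l2" and p2: "pushout C o2 k2 c2 p2"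
  obtains \<delta> l r s where "fpc C (j \<cdot> a) n \<delta> l" "pushout C (t2 \<cdot> e) \<delta> r s" "Cod C r = Cod C c2"
proof -
  obtain \<beta> where \<beta>: "fpc C b h \<beta> l2" "\<beta> \<cdot> \<kappa> = k2"
    using fpc_cancel[OF fb f2 M(1-3) mh] by blast
  have im: "Cod C i2 = Dom C m2'"
    using fpcD(6)[OF fb] .
  have "h \<cdot> m2' \<in> M"
    using M_Comp[OF M(2,3) mh] .
  then have l2: "l2 \<in> M"
    using fpc_M[OF M(1) _ f2] by simp
  have b: "b \<in> M"
    using fpc_M[OF M(1,2) fb] by simp
  have "p1 \<in> M"
    using pushout_M[OF M(5) pu] .
  have cod: "Cod C l2 = Cod C p1"
    using fpcD(1-8)[OF \<beta>(1)] pushoutD(1-8)[OF pu] by simp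
  \<comment> \<open>The intersection of the two context objects inside the intermediate object is
    the context object of the composite derivation.\<close>
  obtain x y where xy: "pullback C x y l2 p1"
    using pullback_along_M_ex[OF l2, of p1] \<open>p1 \<in> M\<close> cod by auto
  have y: "y \<in> M"
    using pullback_M[OF l2 xy] .
  obtain \<delta> where \<delta>: "fpc C a u \<delta> y" "pullback C \<delta> a y u" "x \<cdot> \<delta> = \<beta> \<cdot> e"
    using fpc_base_change[OF \<beta>(1) pushout_pullback[OF pu M(5)] pb xy l2] .
  have l1: "l1 \<in> M"
    using fpc_M[OF M(6,4) fn] by simp
  have fin: "fpc C (j \<cdot> a) n \<delta> (l1 \<cdot> y)"
    using fpc_paste[OF fn \<delta>(1) l1 y] .
  have a: "a \<in> M"
    using pullback_M[OF b pb] .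
  \<comment> \<open>This is the pushout \<open>pu\<close> pulled back along
    \<open>l2\<close>.\<close>
  have poe: "pushout C e \<delta> \<beta> x"
  proof (rule pushout_sym, rule van_Kampen_pushout[OF pushout_sym[OF pu] _ a y b l2])
    show "u \<in> M"
      using pushout_complement_M[OF pu M(5,3)] .
    show "pullback C \<delta> a y u" "pullback C e a b v" "pullback C x y l2 p1"
      by fact+
    show "pullback C \<beta> b l2 h"
      using pullback_sym[OF fpc_pullback[OF \<beta>(1)]] .
  qed
  obtain K N L Q Q2 Y where ty: "\<kappa> \<in> hom C K N" "\<beta> \<in> hom C N L" "o2 \<in> hom C K Q"
    "s2 \<in> hom C Q Q2" "t2 \<in> hom C N Q2" "c2 \<in> hom C Q Y" "p2 \<in> hom C L Y" "k2 \<in> hom C K L"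
    by (rule that) (use fpcD(1-8)[OF \<beta>(1)] fpcD(1-8)[OF fb] pushoutD(1-8)[OF po2]
        pushoutD(1-8)[OF p2] fpcD(1-8)[OF f2] in auto)
  have "c2 \<cdot> o2 = (p2 \<cdot> \<beta>) \<cdot> \<kappa>"
    using pushoutD(9)[OF p2] \<beta>(2) ty by simp
  \<comment> \<open>The comatch \<open>c2\<close> factors through the pushout \<open>po2\<close> as
    \<open>\<gamma> \<cdot> s2\<close>, and cancelling \<open>po2\<close> leaves the pushout of
    \<open>\<beta>\<close> and \<open>t2\<close>.\<close>
  then obtain \<gamma> where \<gamma>: "\<gamma> \<in> hom C Q2 Y" "\<gamma> \<cdot> s2 = c2" "\<gamma> \<cdot> t2 = p2 \<cdot> \<beta>"
    by - (rule pushout_induce[OF po2 ty(4,5,6), of "p2 \<cdot> \<beta>"], use ty in auto)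
  have "pushout C (\<beta> \<cdot> \<kappa>) o2 p2 (\<gamma> \<cdot> s2)"
    using pushout_sym[OF p2] \<beta>(2) \<gamma>(2) by simp
  moreover have "comm_square C \<beta> t2 p2 \<gamma>"
    using \<gamma> ty by (intro comm_squareI) simp_all
  ultimately have "pushout C \<beta> t2 p2 \<gamma>"
    using pushout_sym[OF po2] by - (rule pushout_cancel)
  then have "pushout C (t2 \<cdot> e) \<delta> \<gamma> (p2 \<cdot> x)"
    using pushout_paste[OF poe pushout_sym] by blast
  then show thesis
    using that[OF fin] \<gamma> ty by simp
qed

end

text \<open>These are the conditions for membership in \<open>overlaps\<close> other than
  satisfiability of the composite condition. In the synthesis the diagram is set up first, and
  satisfiability is obtained from the match constructed in it.\<close>

locale sqpo_overlap = sqpo_category C M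
  for C :: "('o, 'm) category_data" (structure) and M :: "'m set" +
  fixes R1 R2 :: "('m, 'i) rule" and \<mu> :: "'m \<times> 'm"
  assumes linear1: "linear_rule C M R1" and linear2: "linear_rule C M R2"
    and span_M: "fst \<mu> \<in> M" "snd \<mu> \<in> M" and span_Dom: "Dom C (fst \<mu>) = Dom C (snd \<mu>)"
    and span_Cod: "Cod C (fst \<mu>) = Cod C (inm R2)" "Cod C (snd \<mu>) = Cod C (outm R1)"
    and poc: "has_poc C (outm R1) (snd (comp_union C \<mu>))"
begin

text \<open>The legs \<open>uI : I\<^sub>2 \<rightarrow> N\<^sub>2\<^sub>1\<close>, \<open>uO : O\<^sub>1 \<rightarrow> N\<^sub>2\<^sub>1\<close> of the union, \<open>fK : K\<^sub>2 \<rightarrow> K\<^sub>2'\<close>, \<open>fN : K\<^sub>2' \<rightarrow> N\<^sub>2\<^sub>1\<close>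
  of the final pullback complement, \<open>pK : K\<^sub>1 \<rightarrow> K\<^sub>1'\<close>, \<open>pN : K\<^sub>1' \<rightarrow> N\<^sub>2\<^sub>1\<close> of the pushout complement,
  \<open>oO : O\<^sub>2 \<rightarrow> O\<^sub>2\<^sub>1\<close>, \<open>oK : K\<^sub>2' \<rightarrow> O\<^sub>2\<^sub>1\<close>, \<open>iI : I\<^sub>1 \<rightarrow> I\<^sub>2\<^sub>1\<close>, \<open>iK : K\<^sub>1' \<rightarrow> I\<^sub>2\<^sub>1\<close>,
  \<open>xK2 : K\<^sub>2\<^sub>1 \<rightarrow> K\<^sub>2'\<close> and \<open>xK1 : K\<^sub>2\<^sub>1 \<rightarrow> K\<^sub>1'\<close>.\<close>

abbreviation "uI \<equiv> fst (comp_union C \<mu>)"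
abbreviation "uO \<equiv> snd (comp_union C \<mu>)"
abbreviation "fK \<equiv> fst (comp_fpc2 C R2 \<mu>)"
abbreviation "fN \<equiv> snd (comp_fpc2 C R2 \<mu>)"
abbreviation "pK \<equiv> fst (comp_poc1 C \<mu> R1)"
abbreviation "pN \<equiv> snd (comp_poc1 C \<mu> R1)"
abbreviation "oO \<equiv> fst (comp_out C R2 \<mu>)"
abbreviation "oK \<equiv> snd (comp_out C R2 \<mu>)"
abbreviation "iI \<equiv> fst (comp_in C \<mu> R1)"
abbreviation "iK \<equiv> snd (comp_in C \<mu> R1)"
abbreviation "xK2 \<equiv> fst (comp_ctx C R2 \<mu> R1)"
abbreviation "xK1 \<equiv> snd (comp_ctx C R2 \<mu> R1)"
abbreviation "R21 \<equiv> comp_rule C M R2 \<mu> R1"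

section \<open>Universal properties and \<open>M\<close>-membership in the composition
  diagram\<close>

lemma rule_M: "inm R1 \<in> M" "outm R1 \<in> M" "inm R2 \<in> M" "outm R2 \<in> M"
  "Dom C (outm R1) = Dom C (inm R1)" "Dom C (outm R2) = Dom C (inm R2)"
  using linear1 linear2 by (simp_all add: linear_rule_def)

lemma union_pushout: "pushout C (fst \<mu>) (snd \<mu>) uI uO"
  unfolding comp_union_def using the_pushout_pushout span_M span_Dom by simp

lemma union_M: "uI \<in> M" "uO \<in> M"
  using pushout_M[OF span_M(1) union_pushout] pushout_M'[OF span_M(2) union_pushout] by simp_all

lemma fpc2_fpc: "fpc C (inm R2) uI fK fN"
  unfolding comp_fpc2_def
  using the_fpc_fpc[OF rule_M(3) union_M(1)] pushoutD(6)[OF union_pushout] span_Cod by simp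

lemma fpc2_M: "fK \<in> M" "fN \<in> M"
  using fpc_M[OF rule_M(3) union_M(1) fpc2_fpc] by simp_all

lemma poc1_pushout: "pushout C (outm R1) pK uO pN"
  unfolding comp_poc1_def using the_poc_pushout[OF poc] .

lemma poc1_M: "pK \<in> M" "pN \<in> M"
  using pushout_complement_M[OF poc1_pushout rule_M(2) union_M(2)]
    pushout_M[OF rule_M(2) poc1_pushout] by simp_all

lemma out_pushout: "pushout C (outm R2) fK oO oK"
  unfolding comp_out_def
  using the_pushout_pushout[OF rule_M(4), of fK] fpc2_M(1) fpcD(5)[OF fpc2_fpc] rule_M(6) by simp

lemma in_pushout: "pushout C (inm R1) pK iI iK"
  unfolding comp_in_def
  using the_pushout_pushout[OF rule_M(1), of pK] poc1_M(1) pushoutD(5)[OF poc1_pushout] rule_M(5)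
  by simp

lemma in_M: "iI \<in> M" "iK \<in> M"
  using pushout_M[OF rule_M(1) in_pushout] pushout_M'[OF poc1_M(1) in_pushout] by simp_all

lemma ctx_pullback: "pullback C xK2 xK1 fN pN"
proof -
  have "Cod C fN = Cod C pN"
    using fpcD(8)[OF fpc2_fpc] pushoutD(8)[OF union_pushout] pushoutD(8)[OF poc1_pushout] by simp
  then show ?thesis
    unfolding comp_ctx_def using the_pullback_pullback[OF fpc2_M(2), of pN] poc1_M(2) by simp
qed

lemma ctx_M: "xK2 \<in> M" "xK1 \<in> M"
  using pullback_M[OF fpc2_M(2) ctx_pullback] pullback_M'[OF poc1_M(2) ctx_pullback] by simp_all

lemma comp_rule_M: "inm R21 \<in> M" "outm R21 \<in> M" "Cod C (inm R21) = Cod C iK"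
proof -
  have "Cod C xK1 = Dom C iK"
    using pullbackD(7)[OF ctx_pullback] pushoutD(7)[OF poc1_pushout] pushoutD(7)[OF in_pushout]
    by simp
  moreover have "Cod C xK2 = Dom C oK"
    using pullbackD(6)[OF ctx_pullback] fpcD(7)[OF fpc2_fpc] pushoutD(7)[OF out_pushout] by simp
  moreover have "oK \<in> M"
    using pushout_M[OF rule_M(4) out_pushout] .
  ultimately show "inm R21 \<in> M" "outm R21 \<in> M" "Cod C (inm R21) = Cod C iK"
    using M_Comp[of xK1 iK] M_Comp[of xK2 oK] ctx_M in_M by (simp_all add: comp_rule_def)
qed

text \<open>The match itself witnesses that the composite condition is not equivalent to
  \<open>CFalse\<close>.\<close>

lemma overlapsI:
  assumes "n \<in> matches C M R21 X"
  shows "\<mu> \<in> overlaps C M R2 R1"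
proof -
  have "n \<in> M" "Dom C n = Cod C iI" "sat C M (comp_cond C M R2 \<mu> R1) n"
    using assms comp_rule_M(3) pushoutD(8)[OF in_pushout]
    by (simp_all add: matches_def comp_rule_def)
  then have "\<not> cond_equiv C M (Cod C iI) (comp_cond C M R2 \<mu> R1) CFalse"
    unfolding cond_equiv_def by (metis sat_CFalse)
  then show ?thesis
    using span_M span_Dom span_Cod poc by (simp add: overlaps_def)
qed

context
  fixes m1 :: 'm
  assumes m1: "m1 \<in> M" "Dom C m1 = Cod C (inm R1)"
begin

text \<open>The derivation \<open>K\<^sub>1 \<rightarrow> L\<^sub>1 \<rightarrow> X\<^sub>0\<close>, \<open>O\<^sub>1 \<rightarrow> X\<^sub>1 \<leftarrow> L\<^sub>1\<close> at \<open>m\<^sub>1\<close> consists of \<open>lK\<close>, \<open>lX\<close>, \<open>qO\<close>, \<open>qL\<close>.\<close>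

abbreviation "lK \<equiv> fst (sqpo_fpc C R1 m1)"
abbreviation "lX \<equiv> snd (sqpo_fpc C R1 m1)"
abbreviation "qO \<equiv> fst (sqpo_pushout C R1 m1)"
abbreviation "qL \<equiv> snd (sqpo_pushout C R1 m1)"

lemma step_fpc: "fpc C (inm R1) m1 lK lX"
  unfolding sqpo_fpc_def using the_fpc_fpc[OF rule_M(1) m1(1)] m1(2) by simp

lemma step_M: "lK \<in> M" "lX \<in> M"
  using fpc_M[OF rule_M(1) m1(1) step_fpc] by simp_all

lemma step_pushout: "pushout C (outm R1) lK qO qL"
  unfolding sqpo_pushout_def
  using the_pushout_pushout[OF rule_M(2), of lK] step_M(1) fpcD(5)[OF step_fpc] rule_M(5) by simp

lemma step_pushout_M: "qO \<in> M" "qL \<in> M"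
  using pushout_M[OF rule_M(2) step_pushout] pushout_M'[OF step_M(1) step_pushout] by simp_all

text \<open>Here \<open>n\<close> and \<open>h\<close> are match and comatch of one derivation of
  the span \<open>N\<^sub>2\<^sub>1 \<leftarrow> K\<^sub>1' \<rightarrow> I\<^sub>2\<^sub>1\<close>.
  Synthesis reaches this situation from \<open>h\<close>, analysis from \<open>n\<close>, and both
  use the conclusions drawn from it.\<close>

context
  fixes h n u :: 'm
  assumes n: "n \<in> M" "n \<cdot> iI = m1" and h: "h \<in> M" "h \<cdot> uO = qO" and u: "u \<cdot> pK = lK"
    and ext_fpc: "fpc C iK n u lX" and ext_pushout: "pushout C pN u h qL"
begin

lemma ext_Dom_Cod: "Dom C n = Cod C iK" "Cod C n = Cod C m1" "Dom C h = Cod C uI"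
  "Cod C h = rewrite C R1 m1" "Dom C u = Cod C pK" "Cod C u = Cod C lK" "u \<in> Arr C"
proof -
  show "Dom C n = Cod C iK"
    using fpcD(6)[OF ext_fpc] by simp
  show "Cod C n = Cod C m1"
    using fpcD(8)[OF ext_fpc] fpcD(8)[OF step_fpc] by simp
  show "Dom C h = Cod C uI"
    using pushoutD(6)[OF ext_pushout] pushoutD(8)[OF union_pushout] pushoutD(8)[OF poc1_pushout]
    by simp
  show "Cod C h = rewrite C R1 m1"
    using pushoutD(8)[OF ext_pushout] pushoutD(8)[OF step_pushout] by (simp add: rewrite_def)
  show "Dom C u = Cod C pK"
    using pushoutD(5)[OF ext_pushout] pushoutD(7)[OF poc1_pushout] by simp
  show "Cod C u = Cod C lK"
    using fpcD(7)[OF ext_fpc] fpcD(7)[OF step_fpc] by simp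
  show "u \<in> Arr C"
    using fpcD(2)[OF ext_fpc] .
qed

lemma ext_same_diagram: "same_diagram C \<mu> R1 m1 (h \<cdot> uI) n"
  unfolding same_diagram_def
proof (intro bexI conjI)
  show "h \<in> hom C (Cod C uO) (rewrite C R1 m1)"
    using ext_Dom_Cod h pushoutD(8)[OF union_pushout] by simp
  show "u \<in> hom C (Cod C pK) (Cod C lK)"
    using ext_Dom_Cod by simp
  show "n \<cdot> iK = lX \<cdot> u" "h \<cdot> pN = qL \<cdot> u"
    using fpcD(9)[OF ext_fpc] pushoutD(9)[OF ext_pushout] by simp_all
qed (use n h in simp_all)

text \<open>\<open>Trans\<close> carries the second condition from \<open>n\<close> to the comatch
  \<open>h\<close>, and \<open>Shift\<close> restricts it to \<open>h \<cdot> uI\<close>; for the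
  first condition \<open>Shift\<close> alone suffices because
  \<open>n \<cdot> iI = m1\<close>.\<close>

lemma ext_sat:
  "sat C M (acond R21) n \<longleftrightarrow> sat C M (acond R1) m1 \<and> sat C M (acond R2) (h \<cdot> uI)"
proof -
  have Cod: "Cod C uI = Cod C pN" "Dom C uI = Cod C (inm R2)" "Dom C iI = Cod C (inm R1)"
    using pushoutD(8)[OF union_pushout] pushoutD(8)[OF poc1_pushout] fpcD(6)[OF fpc2_fpc]
      pushoutD(6)[OF in_pushout] by simp_all
  have over: "cond_over C M (acond R1) (Dom C iI)" "cond_over C M (acond R2) (Dom C uI)"
    using linear1 linear2 Cod by (simp_all add: linear_rule_def)
  have "cond_over C M (Shift C M (acond R2) uI) (Cod C pN)"
    using cond_over_Shift[OF over(2) union_M(1)] Cod by simp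
  then have "sat C M (Trans C (Shift C M (acond R2) uI) pN iK) n \<longleftrightarrow>
      sat C M (Shift C M (acond R2) uI) h"
    by (rule sat_Trans[OF _ poc1_M(2) in_M(2) n(1) h(1) ext_fpc ext_pushout])
  also have "\<dots> \<longleftrightarrow> sat C M (acond R2) (h \<cdot> uI)"
    using sat_Shift[OF over(2) union_M(1) h(1)] ext_Dom_Cod by simp
  finally show ?thesis
    using sat_Shift[OF over(1) in_M(1) n(1)] ext_Dom_Cod n(2) pushoutD(8)[OF in_pushout]
    by (simp add: comp_rule_def comp_cond_def sat_CAnd)
qed

lemma ext_isomorphic: "isomorphic C (rewrite C R21 n) (rewrite C R2 (h \<cdot> uI))"
proof -
  have hu: "h \<cdot> uI \<in> M" "Dom C (h \<cdot> uI) = Cod C (inm R2)"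
    using M_Comp[OF union_M(1) h(1)] ext_Dom_Cod union_M h fpcD(6)[OF fpc2_fpc] by simp_all
  define k2 l2 c2 p2 where d: "k2 = fst (sqpo_fpc C R2 (h \<cdot> uI))" "l2 = snd (sqpo_fpc C R2 (h \<cdot> uI))"
    "c2 = fst (sqpo_pushout C R2 (h \<cdot> uI))" "p2 = snd (sqpo_pushout C R2 (h \<cdot> uI))"
  have f2: "fpc C (inm R2) (h \<cdot> uI) k2 l2"
    unfolding d sqpo_fpc_def using the_fpc_fpc[OF rule_M(3) hu(1)] hu(2) by simp
  have "pushout C (outm R2) k2 c2 p2"
    unfolding d(3,4) sqpo_pushout_def d(1)[symmetric]
    using the_pushout_pushout[OF rule_M(4), of k2] fpcD(2,5)[OF f2] rule_M(6) by simp
  from composite_derivation[OF rule_M(3) union_M(1) h(1) n(1) poc1_M(2) in_M(2) _ fpc2_fpc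
      out_pushout ctx_pullback ext_fpc ext_pushout f2 this]
  obtain \<delta> l r s where "fpc C (iK \<cdot> xK1) n \<delta> l" "pushout C (oK \<cdot> xK2) \<delta> r s" "Cod C r = Cod C c2"
    using ext_Dom_Cod by metis
  then show ?thesis
    using rewrite_isomorphic[OF comp_rule_M(1,2) n(1), of \<delta> l r s]
    by (simp add: comp_rule_def rewrite_def d)
qed

end

text \<open>The rule of the derivation at \<open>m1\<close> is extended along
  \<open>O\<^sub>1 \<rightarrow> N\<^sub>2\<^sub>1\<close>, with \<open>h\<close> as the new
  comatch.\<close>

lemma extension_of_union:
  assumes h: "h \<in> M" "h \<cdot> uO = qO" "Dom C h = Cod C uO"
  obtains n u where "n \<in> M" "n \<cdot> iI = m1" "u \<cdot> pK = lK" "fpc C iK n u lX" "pushout C pN u h qL"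
proof -
  have "pushout C (outm R1) lK (h \<cdot> uO) qL"
    using step_pushout h by simp
  then show thesis
    using extend_match_forward[OF rule_M(2,1) m1(1) union_M(2) h(1) _ step_fpc _ poc1_pushout
        in_pushout] h(3) that by metis
qed

text \<open>This forces the overlap. Decomposition puts \<open>k\<close> in \<open>M\<close>, and
  cancelling the pushout complement from the derivation shows that \<open>h\<close> is opposite to
  \<open>k\<close> in a pushout. Hence \<open>h\<close> is a monomorphism, and the union square, a
  pullback, remains one after composition with \<open>h\<close>.\<close>

lemma same_diagram_pullback:
  assumes n: "n \<in> M" "Dom C n = Cod C iK" and sd: "same_diagram C \<mu> R1 m1 m2 n"
  shows "pullback C (fst \<mu>) (snd \<mu>) m2 qO"
proof -
  obtain h k where h: "h \<in> hom C (Cod C uO) (rewrite C R1 m1)"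
    and k: "k \<in> hom C (Cod C pK) (Cod C lK)"
    and eq: "n \<cdot> iI = m1" "n \<cdot> iK = lX \<cdot> k" "h \<cdot> pN = qL \<cdot> k" "h \<cdot> uO = qO" "h \<cdot> uI = m2"
    using sd unfolding same_diagram_def by blast
  obtain K I L X where ty1: "inm R1 \<in> hom C K I" "m1 \<in> hom C I X" "lK \<in> hom C K L" "lX \<in> hom C L X"
    by (rule that) (use fpcD(1-8)[OF step_fpc] in auto)
  obtain Q Y where ty2: "outm R1 \<in> hom C K Q" "qO \<in> hom C Q Y" "qL \<in> hom C L Y"
    by (rule that) (use pushoutD(1-8)[OF step_pushout] ty1 in auto)
  obtain K' N where ty3: "pK \<in> hom C K K'" "uO \<in> hom C Q N" "pN \<in> hom C K' N"
    by (rule that) (use pushoutD(1-8)[OF poc1_pushout] ty2 in auto)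
  obtain J where ty4: "iI \<in> hom C I J" "iK \<in> hom C K' J"
    by (rule that) (use pushoutD(1-8)[OF in_pushout] ty1 ty3 in auto)
  have ty5: "h \<in> hom C N Y" "k \<in> hom C K' L" "n \<in> hom C J (Cod C n)"
    using h k ty1 ty2 ty3 ty4 n by (simp_all add: rewrite_def)
  have "Cod C n = X"
    using ty1 ty4 ty5 eq(1) by auto
  note ty = ty1 ty2 ty3 ty4 ty5
  have "lX \<cdot> k \<in> M"
    using M_Comp[OF in_M(2) n(1)] ty eq(2) by simp
  then have kM: "k \<in> M"
    using M_decomp[OF _ step_M(2), of k] ty by simp
  have "lX \<cdot> (k \<cdot> pK) = n \<cdot> (iK \<cdot> pK)"
    using ty by (simp add: Comp_eq_Comp[OF eq(2)])
  also have "\<dots> = m1 \<cdot> inm R1"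
    using Comp_eq[OF eq(1), of "inm R1"] ty pushoutD(9)[OF in_pushout] by simp
  also have "\<dots> = lX \<cdot> lK"
    using fpcD(9)[OF step_fpc] .
  finally have "k \<cdot> pK = lK"
    using ty by - (rule monoD[OF M_mono[OF step_M(2)] ty1(4), of _ K], simp_all)
  then have "pushout C (k \<cdot> pK) (outm R1) qL (h \<cdot> uO)"
    using pushout_sym[OF step_pushout] eq(4) by simp
  moreover have "comm_square C k pN qL h"
    using ty eq(3) by (intro comm_squareI) simp_all
  ultimately have "pushout C k pN qL h"
    using pushout_sym[OF poc1_pushout] by - (rule pushout_cancel)
  then have "h \<in> M"
    using pushout_M[OF kM] by simp
  then show ?thesis
    using pullback_Comp_mono[OF pushout_pullback[OF union_pushout span_M(1)], of h] ty eq(4,5)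
      M_mono pushoutD(8)[OF union_pushout] by simp
qed

text \<open>The data are determined in turn: \<open>h\<close> by the union, \<open>k\<close> because
  \<open>qL\<close> is a monomorphism, and \<open>n\<close> by the pushout
  \<open>I\<^sub>2\<^sub>1\<close>.\<close>

lemma same_diagram_match_unique:
  assumes n: "n \<in> hom C (Cod C iK) X" "same_diagram C \<mu> R1 m1 m2 n"
    and n': "n' \<in> hom C (Cod C iK) X" "same_diagram C \<mu> R1 m1 m2 n'"
  shows "n = n'"
proof -
  obtain h k where h: "h \<in> hom C (Cod C uO) (rewrite C R1 m1)"
    and k: "k \<in> hom C (Cod C pK) (Cod C lK)"
    and eq: "n \<cdot> iI = m1" "n \<cdot> iK = lX \<cdot> k" "h \<cdot> pN = qL \<cdot> k" "h \<cdot> uO = qO" "h \<cdot> uI = m2"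
    using n(2) unfolding same_diagram_def by blast
  obtain h' k' where h': "h' \<in> hom C (Cod C uO) (rewrite C R1 m1)"
    and k': "k' \<in> hom C (Cod C pK) (Cod C lK)"
    and eq': "n' \<cdot> iI = m1" "n' \<cdot> iK = lX \<cdot> k'" "h' \<cdot> pN = qL \<cdot> k'" "h' \<cdot> uO = qO" "h' \<cdot> uI = m2"
    using n'(2) unfolding same_diagram_def by blast
  have ty: "uI \<in> hom C (Dom C uI) (Cod C uO)" "uO \<in> hom C (Dom C uO) (Cod C uO)"
    "iI \<in> hom C (Dom C iI) (Cod C iK)" "iK \<in> hom C (Dom C iK) (Cod C iK)"
    "qL \<in> hom C (Cod C lK) (Cod C qL)"
    using union_M in_M step_pushout_M pushoutD(8)[OF union_pushout] pushoutD(8)[OF in_pushout]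
      pushoutD(7)[OF step_pushout] by simp_all
  have "h = h'"
    using pushout_unique[OF union_pushout ty(1,2) h h'] eq eq' by simp
  then have "k = k'"
    using monoD[OF M_mono[OF step_pushout_M(2)] ty(5) k k'] eq(3) eq'(3) by simp
  then show ?thesis
    using pushout_unique[OF in_pushout ty(3,4) n(1) n'(1)] eq(1,2) eq'(1,2) by simp
qed

text \<open>Read in the opposite order, \<open>k\<close> is determined because \<open>lX\<close> is
  a monomorphism, then \<open>h\<close> by the pushout \<open>N\<^sub>2\<^sub>1\<close> of the
  complement, and finally \<open>m2\<close> as a restriction of \<open>h\<close>.\<close>

lemma same_diagram_second_match_unique:
  assumes "same_diagram C \<mu> R1 m1 m2 n" "same_diagram C \<mu> R1 m1 m2' n"
  shows "m2 = m2'"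
proof -
  obtain h k where h: "h \<in> hom C (Cod C uO) (rewrite C R1 m1)"
    and k: "k \<in> hom C (Cod C pK) (Cod C lK)"
    and eq: "n \<cdot> iK = lX \<cdot> k" "h \<cdot> pN = qL \<cdot> k" "h \<cdot> uO = qO" "h \<cdot> uI = m2"
    using assms(1) unfolding same_diagram_def by blast
  obtain h' k' where h': "h' \<in> hom C (Cod C uO) (rewrite C R1 m1)"
    and k': "k' \<in> hom C (Cod C pK) (Cod C lK)"
    and eq': "n \<cdot> iK = lX \<cdot> k'" "h' \<cdot> pN = qL \<cdot> k'" "h' \<cdot> uO = qO" "h' \<cdot> uI = m2'"
    using assms(2) unfolding same_diagram_def by blast
  have ty: "uO \<in> hom C (Dom C uO) (Cod C uO)" "pN \<in> hom C (Dom C pN) (Cod C uO)"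
    "lX \<in> hom C (Cod C lK) (Cod C lX)"
    using union_M poc1_M step_M pushoutD(8)[OF poc1_pushout] fpcD(7)[OF step_fpc] by simp_all
  have "k = k'"
    using monoD[OF M_mono[OF step_M(2)] ty(3) k k'] eq(1) eq'(1) by simp
  then have "h = h'"
    using pushout_unique[OF poc1_pushout ty(1,2) h h'] eq(2,3) eq'(2,3) by simp
  then show ?thesis
    using eq(4) eq'(4) by simp
qed

end

end

section \<open>Synthesis and analysis of two-step derivations\<close>

context sqpo_category
begin

lemma synthesis:
  fixes R1 R2 :: "('m, 'i) rule"
  assumes lin: "linear_rule C M R1" "linear_rule C M R2"
    and m1: "m1 \<in> matches C M R1 X0" and m2: "m2 \<in> matches C M R2 (rewrite C R1 m1)"
  shows "\<exists>\<mu> \<in> overlaps C M R2 R1.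
     (\<exists>!n. n \<in> matches C M (comp_rule C M R2 \<mu> R1) X0 \<and> same_diagram C \<mu> R1 m1 m2 n \<and>
           isomorphic C (rewrite C (comp_rule C M R2 \<mu> R1) n) (rewrite C R2 m2)) \<and>
     (\<forall>\<mu>' \<in> overlaps C M R2 R1.
        (\<exists>n'. n' \<in> matches C M (comp_rule C M R2 \<mu>' R1) X0 \<and> same_diagram C \<mu>' R1 m1 m2 n' \<and>
              isomorphic C (rewrite C (comp_rule C M R2 \<mu>' R1) n') (rewrite C R2 m2)) \<longrightarrow>
        span_iso C \<mu> \<mu>')"
proof -
  have M: "inm R1 \<in> M" "outm R1 \<in> M" "Dom C (outm R1) = Dom C (inm R1)"
    using lin by (simp_all add: linear_rule_def)
  have m1': "m1 \<in> M" "Dom C m1 = Cod C (inm R1)" "Cod C m1 = X0" "sat C M (acond R1) m1"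
    and m2': "m2 \<in> M" "Dom C m2 = Cod C (inm R2)" "Cod C m2 = rewrite C R1 m1" "sat C M (acond R2) m2"
    using m1 m2 by (simp_all add: matches_def)
  define k l c p where d: "k = fst (sqpo_fpc C R1 m1)" "l = snd (sqpo_fpc C R1 m1)"
    "c = fst (sqpo_pushout C R1 m1)" "p = snd (sqpo_pushout C R1 m1)"
  have f: "fpc C (inm R1) m1 k l"
    unfolding d sqpo_fpc_def using the_fpc_fpc[OF M(1) m1'(1)] m1' by simp
  have po: "pushout C (outm R1) k c p"
    unfolding d(3,4) sqpo_pushout_def d(1)[symmetric]
    using the_pushout_pushout[OF M(2), of k] fpcD(2,5)[OF f] M(3) by simp
  have c: "c \<in> M"
    using pushout_M'[OF _ po] fpc_M[OF M(1) m1'(1) f] by simp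
  have "Cod C m2 = Cod C c"
    using m2' by (simp add: rewrite_def d)
  \<comment> \<open>The overlap is the intersection of the second match with the comatch of the
    first.\<close>
  then obtain x y where pb: "pullback C x y m2 c"
    using pullback_along_M_ex[OF m2'(1)] c M_Arr by metis
  have xy: "x \<in> M" "y \<in> M"
    using pullback_M[OF m2'(1) pb] pullback_M'[OF c pb] by simp_all
  define \<mu> where "\<mu> = (x, y)"
  define a1 a2 where a: "a1 = fst (comp_union C \<mu>)" "a2 = snd (comp_union C \<mu>)"
  have pu: "pushout C x y a1 a2"
    unfolding a comp_union_def \<mu>_def using the_pushout_pushout[OF xy(1), of y] xy pullbackD(5)[OF pb]
    by simp
  obtain W I Q N Y where ty: "x \<in> hom C W I" "y \<in> hom C W Q" "m2 \<in> hom C I Y" "c \<in> hom C Q Y"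
      "a1 \<in> hom C I N" "a2 \<in> hom C Q N"
    by (rule that) (use pullbackD(1-8)[OF pb] pushoutD(1-8)[OF pu] in auto)
  obtain h where h: "h \<in> hom C N Y" "h \<cdot> a1 = m2" "h \<cdot> a2 = c"
    using pushout_induce[OF pu ty(5,6,3,4) pullbackD(9)[OF pb]] .
  have hM: "h \<in> M"
    using M_effective_unions[OF xy pu m2'(1) c pb _ h(2,3)] h(1) ty by simp
  \<comment> \<open>The comatch \<open>c\<close> equals \<open>h \<cdot> a2\<close> and lies in the
    pushout \<open>po\<close>, so pulling \<open>po\<close> back along \<open>h\<close> provides the
    pushout complement needed for the composite.\<close>
  have "a2 \<in> M"
    using pushout_M[OF xy(1) pu] .
  then have "has_poc C (outm R1) a2"
    using has_poc_if_pushout[OF M(2) _ hM, of a2 k p] po h ty by simp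
  then interpret sqpo_overlap C M R1 R2 \<mu>
    using lin xy ty pushoutD(6)[OF po] m2'
    by unfold_locales (simp_all add: \<mu>_def a(2)[symmetric, unfolded \<mu>_def])
  obtain n u where n: "n \<in> M" "n \<cdot> iI = m1" "u \<cdot> pK = k" "fpc C iK n u l" "pushout C pN u h p"
    using extension_of_union[OF m1'(1,2) hM] h ty unfolding d a by auto
  note ext = m1'(1,2) n(1,2) hM h(3)[unfolded a d] n(3-5)[unfolded d]
  have tyn: "Dom C n = Cod C iK" "Cod C n = X0"
    using ext_Dom_Cod(1,2)[OF ext] m1' by simp_all
  have sd: "same_diagram C \<mu> R1 m1 m2 n"
    using ext_same_diagram[OF ext] h(2) a by simp
  have nm: "n \<in> matches C M R21 X0"
    using ext_sat[OF ext] n(1) tyn comp_rule_M(3) m1'(4) m2'(4) h(2) a by (simp add: matches_def)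
  have iso: "isomorphic C (rewrite C R21 n) (rewrite C R2 m2)"
    using ext_isomorphic[OF ext] h(2) a by simp
  show ?thesis
  proof (intro bexI[OF _ overlapsI[OF nm]] conjI ballI impI)
    show "\<exists>!n. n \<in> matches C M R21 X0 \<and> same_diagram C \<mu> R1 m1 m2 n \<and>
        isomorphic C (rewrite C R21 n) (rewrite C R2 m2)"
    proof (rule ex1I)
      show "n \<in> matches C M R21 X0 \<and> same_diagram C \<mu> R1 m1 m2 n \<and>
          isomorphic C (rewrite C R21 n) (rewrite C R2 m2)"
        using nm sd iso by simp
      fix n' assume n': "n' \<in> matches C M R21 X0 \<and> same_diagram C \<mu> R1 m1 m2 n' \<and>
          isomorphic C (rewrite C R21 n') (rewrite C R2 m2)"
      have "n' \<in> hom C (Cod C iK) X0" "n \<in> hom C (Cod C iK) X0"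
        using n' nm comp_rule_M(3) by (simp_all add: matches_def)
      then show "n' = n"
        using same_diagram_match_unique[OF m1'(1,2)] n' sd by blast
    qed
    fix \<mu>' assume \<mu>': "\<mu>' \<in> overlaps C M R2 R1" and
      "\<exists>n'. n' \<in> matches C M (comp_rule C M R2 \<mu>' R1) X0 \<and> same_diagram C \<mu>' R1 m1 m2 n' \<and>
        isomorphic C (rewrite C (comp_rule C M R2 \<mu>' R1) n') (rewrite C R2 m2)"
    then obtain n' where n': "n' \<in> matches C M (comp_rule C M R2 \<mu>' R1) X0"
      "same_diagram C \<mu>' R1 m1 m2 n'"
      by blast
    interpret o': sqpo_overlap C M R1 R2 \<mu>'
      using lin \<mu>' by unfold_locales (simp_all add: overlaps_def)
    have "n' \<in> M" "Dom C n' = Cod C (snd (comp_in C \<mu>' R1))"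
      using n'(1) o'.comp_rule_M(3) by (simp_all add: matches_def)
    \<comment> \<open>Any competing overlap is a pullback of the same pair \<open>m2\<close>,
      \<open>c\<close>, hence isomorphic to \<open>\<mu>\<close> as a span.\<close>
    then have pb': "pullback C (fst \<mu>') (snd \<mu>') m2 c"
      using o'.same_diagram_pullback[OF m1'(1,2) _ _ n'(2)] by (simp add: d)
    show "span_iso C \<mu> \<mu>'"
      using pullback_isomorphic[OF pb pb'] unfolding span_iso_def \<mu>_def fst_conv snd_conv by blast
  qed
qed

lemma analysis:
  fixes R1 R2 :: "('m, 'i) rule"
  assumes lin: "linear_rule C M R1" "linear_rule C M R2"
    and \<mu>: "\<mu> \<in> overlaps C M R2 R1" and n: "n \<in> matches C M (comp_rule C M R2 \<mu> R1) X0"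
  shows "\<exists>!(m1, m2). m1 \<in> matches C M R1 X0 \<and> m2 \<in> matches C M R2 (rewrite C R1 m1) \<and>
     same_diagram C \<mu> R1 m1 m2 n \<and>
     isomorphic C (rewrite C R2 m2) (rewrite C (comp_rule C M R2 \<mu> R1) n)"
proof -
  interpret sqpo_overlap C M R1 R2 \<mu>
    using lin \<mu> by unfold_locales (simp_all add: overlaps_def)
  have n': "n \<in> M" "Dom C n = Cod C iK" "Cod C n = X0" "sat C M (acond R21) n"
    using n comp_rule_M(3) by (simp_all add: matches_def)
  have nI: "Dom C n = Cod C iI"
    using n'(2) pushoutD(8)[OF in_pushout] by simp
  define m1 where "m1 = n \<cdot> iI"
  have m1: "m1 \<in> M" "Dom C m1 = Cod C (inm R1)" "Cod C m1 = X0"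
    unfolding m1_def using M_Comp[OF in_M(1) n'(1)] nI in_M n' pushoutD(6)[OF in_pushout] by simp_all
  have "fpc C (inm R1) (n \<cdot> iI) (fst (sqpo_fpc C R1 m1)) (snd (sqpo_fpc C R1 m1))"
    using step_fpc[OF m1(1,2)] by (simp add: m1_def)
  from extend_match_backward[OF rule_M(2,1) n'(1) union_M(2) nI[symmetric] this
      step_pushout[OF m1(1,2)] poc1_pushout in_pushout]
  obtain u h where uh: "fpc C iK n u (snd (sqpo_fpc C R1 m1))"
    "pushout C pN u h (snd (sqpo_pushout C R1 m1))" "u \<cdot> pK = fst (sqpo_fpc C R1 m1)"
    "h \<cdot> uO = fst (sqpo_pushout C R1 m1)" "h \<in> M"
    by blast
  note ext = m1(1,2) n'(1) m1_def[symmetric] uh(5,4,3,1,2)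
  define m2 where "m2 = h \<cdot> uI"
  have m2: "m2 \<in> M" "m2 \<in> hom C (Cod C (inm R2)) (rewrite C R1 m1)"
    unfolding m2_def using M_Comp[OF union_M(1) uh(5)] ext_Dom_Cod[OF ext] union_M(1) uh(5)
      fpcD(6)[OF fpc2_fpc] by simp_all
  have sd: "same_diagram C \<mu> R1 m1 m2 n"
    using ext_same_diagram[OF ext] by (simp add: m2_def)
  have sat: "sat C M (acond R1) m1" "sat C M (acond R2) m2"
    using ext_sat[OF ext] n'(4) by (simp_all add: m2_def)
  have iso: "isomorphic C (rewrite C R2 m2) (rewrite C R21 n)"
    using isomorphic_sym[OF ext_isomorphic[OF ext]] by (simp add: m2_def)
  show ?thesis
  proof (rule ex1I[of _ "(m1, m2)"])
    show "case (m1, m2) of (m1, m2) \<Rightarrow> m1 \<in> matches C M R1 X0 \<and>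
        m2 \<in> matches C M R2 (rewrite C R1 m1) \<and> same_diagram C \<mu> R1 m1 m2 n \<and>
        isomorphic C (rewrite C R2 m2) (rewrite C R21 n)"
      using m1 m2 sat sd iso by (simp add: matches_def)
    fix z assume "case z of (m1, m2) \<Rightarrow> m1 \<in> matches C M R1 X0 \<and>
        m2 \<in> matches C M R2 (rewrite C R1 m1) \<and> same_diagram C \<mu> R1 m1 m2 n \<and>
        isomorphic C (rewrite C R2 m2) (rewrite C R21 n)"
    then obtain m1' m2' where z: "z = (m1', m2')" "same_diagram C \<mu> R1 m1' m2' n"
      by (cases z) simp
    \<comment> \<open>\<open>same_diagram\<close> includes the equation
      \<open>n \<cdot> iI = m1'\<close>, so the first match is determined outright; the second is
      compared only after this identification, within the same first derivation.\<close>
    have "m1' = m1"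
      using z(2) unfolding same_diagram_def m1_def by blast
    moreover from this have "m2' = m2"
      using same_diagram_second_match_unique[OF m1(1,2)] z(2) sd by blast
    ultimately show "z = (m1, m2)"
      using z by simp
  qed
qed

end

theorem theorem5p6:
  fixes C :: "('o, 'm) category_data" and M :: "'m set"
    and R1 R2 :: "('m, 'i) rule" and X0 :: 'o
  assumes "sqpo_category C M"
    and "linear_rule C M R1" and "linear_rule C M R2"
    and "X0 \<in> Obj C"
  shows
    "(\<forall>m1 m2. m1 \<in> matches C M R1 X0 \<longrightarrow> m2 \<in> matches C M R2 (rewrite C R1 m1) \<longrightarrow>
        (\<exists>\<mu> \<in> overlaps C M R2 R1.
           (\<exists>!n. n \<in> matches C M (comp_rule C M R2 \<mu> R1) X0 \<and>
                 same_diagram C \<mu> R1 m1 m2 n \<and>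
                 isomorphic C (rewrite C (comp_rule C M R2 \<mu> R1) n) (rewrite C R2 m2)) \<and>
           (\<forall>\<mu>' \<in> overlaps C M R2 R1.
              (\<exists>n'. n' \<in> matches C M (comp_rule C M R2 \<mu>' R1) X0 \<and>
                    same_diagram C \<mu>' R1 m1 m2 n' \<and>
                    isomorphic C (rewrite C (comp_rule C M R2 \<mu>' R1) n') (rewrite C R2 m2)) \<longrightarrow>
              span_iso C \<mu> \<mu>')))
     \<and>
     (\<forall>\<mu> n. \<mu> \<in> overlaps C M R2 R1 \<longrightarrow> n \<in> matches C M (comp_rule C M R2 \<mu> R1) X0 \<longrightarrow>
        (\<exists>!(m1, m2). m1 \<in> matches C M R1 X0 \<and> m2 \<in> matches C M R2 (rewrite C R1 m1) \<and>
           same_diagram C \<mu> R1 m1 m2 n \<and>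
           isomorphic C (rewrite C R2 m2) (rewrite C (comp_rule C M R2 \<mu> R1) n)))"
proof (intro conjI allI impI)
  interpret sqpo_category C M
    by fact
  fix m1 m2 assume "m1 \<in> matches C M R1 X0" "m2 \<in> matches C M R2 (rewrite C R1 m1)"
  then show "\<exists>\<mu> \<in> overlaps C M R2 R1.
      (\<exists>!n. n \<in> matches C M (comp_rule C M R2 \<mu> R1) X0 \<and> same_diagram C \<mu> R1 m1 m2 n \<and>
            isomorphic C (rewrite C (comp_rule C M R2 \<mu> R1) n) (rewrite C R2 m2)) \<and>
      (\<forall>\<mu>' \<in> overlaps C M R2 R1.
         (\<exists>n'. n' \<in> matches C M (comp_rule C M R2 \<mu>' R1) X0 \<and> same_diagram C \<mu>' R1 m1 m2 n' \<and>
               isomorphic C (rewrite C (comp_rule C M R2 \<mu>' R1) n') (rewrite C R2 m2)) \<longrightarrow>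
         span_iso C \<mu> \<mu>')"
    by (rule synthesis[OF assms(2,3)])
next
  interpret sqpo_category C M
    by fact
  fix \<mu> n assume "\<mu> \<in> overlaps C M R2 R1" "n \<in> matches C M (comp_rule C M R2 \<mu> R1) X0"
  then show "\<exists>!(m1, m2). m1 \<in> matches C M R1 X0 \<and> m2 \<in> matches C M R2 (rewrite C R1 m1) \<and>
      same_diagram C \<mu> R1 m1 m2 n \<and>
      isomorphic C (rewrite C R2 m2) (rewrite C (comp_rule C M R2 \<mu> R1) n)"
    by (rule analysis[OF assms(2,3)])
qed

end
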